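(* There are infinitely many rank 3 points $x\in\mathbb R^2$ with the following property. For every two-dimensional continued fraction expansion $\mu$, writing $\mu(x)=T_0,T_1,\dots$, no subsequence $E_0\supsetneqq E_1\supsetneqq\cdots$ of $T_0,T_1,\dots$ such that all angles of every $E_n$ are $>\arcsin(23^{1/2}/6)$ satisfies $\bigcap_n E_n=\{x\}$. Thus, letting $x_{ni}=(p_{ni}/d_{ni},q_{ni}/d_{ni})$ denote the $i$th vertex of $T_n$ ($i=1,2,3$), we have $$\liminf_{n\to\infty}\frac{\sum_{i=1}^3\operatorname{dist}(x,x_{ni})}{(2d_{n1}d_{n2}d_{n3})^{-1/2}}\ \geq\ \liminf_{n\to\infty}\frac{\operatorname{diam}(T_n)}{\operatorname{area}(T_n)^{1/2}}\ \geq\ 2\cdot\left(\frac{13}{23}\right)^{1/4}.$$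
   Context: A two-dimensional continued fraction expansion is a map $\mu$ assigning to every $x\in\mathbb R^2\setminus\mathbb Q^2$ a sequence $\mu(x)=T_0,T_1,\dots$ of triangles $T_n\subseteq\mathbb R^2$ with rational vertices $(p_{ni}/d_{ni},q_{ni}/d_{ni})$, where $p_{ni},q_{ni},d_{ni}\in\mathbb Z$, $d_{ni}>0$, $i=1,2,3$, such that $\bigcap_n T_n=\{x\}$ and, for every $n$, the $3\times3$ integer matrix with rows $(p_{ni},q_{ni},d_{ni})$, $i=1,2,3$, has determinant $\pm1$. A point $x=(x_1,x_2)\in\mathbb R^2$ is a rank 3 point if the subgroup $\mathbb Zx_1+\mathbb Zx_2+\mathbb Z$ of the additive group $\mathbb R$ has rank 3 (equivalently, $x_1,x_2,1$ are linearly independent over $\mathbb Q$). For a triangle $T$, $\operatorname{diam}(T)$ is the length of its longest side; $\operatorname{dist}$ is euclidean distance. *)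

theory Defs
  imports "HOL-Analysis.Analysis"
begin

section \<open>Rank 3 points\<close>

definition int_scale :: "int \<Rightarrow> real \<Rightarrow> real" where
  "int_scale n r = of_int n * r"

lemma module_int_scale: "module int_scale"
  by unfold_locales (auto simp: int_scale_def algebra_simps)

text \<open>The rank of a subgroup of the reals is the largest size of a subset that is
  linearly independent over the integers.\<close>

definition has_rank :: "real set \<Rightarrow> nat \<Rightarrow> bool" where
  "has_rank A n \<longleftrightarrow>
     (\<exists>B\<subseteq>A. finite B \<and> card B = n \<and> \<not> module.dependent int_scale B) \<and>
     (\<forall>B\<subseteq>A. \<not> module.dependent int_scale B \<longrightarrow> finite B \<and> card B \<le> n)"

definition coord_group :: "real^2 \<Rightarrow> real set" where
  "coord_group x = {of_int a * x $ 1 + of_int b * x $ 2 + of_int c |a b c :: int. True}"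

definition rank3_point :: "real^2 \<Rightarrow> bool" where
  "rank3_point x \<longleftrightarrow> has_rank (coord_group x) 3"


section \<open>Triangles\<close>

definition is_triangle :: "(real^2) set \<Rightarrow> real^2 \<Rightarrow> real^2 \<Rightarrow> real^2 \<Rightarrow> bool" where
  "is_triangle T a b c \<longleftrightarrow> \<not> collinear {a, b, c} \<and> T = convex hull {a, b, c}"

definition angle_at :: "real^2 \<Rightarrow> real^2 \<Rightarrow> real^2 \<Rightarrow> real" where
  "angle_at a b c = arccos (((b - a) \<bullet> (c - a)) / (dist a b * dist a c))"

text \<open>A triangle, being a set, determines its vertices up to order.  In the following
  definitions all orderings \<open>a, b, c\<close> of the vertices occur, so that each set collects
  all three angles or all three side lengths.\<close>

definition triangle_angles :: "(real^2) set \<Rightarrow> real set" where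
  "triangle_angles T = {angle_at a b c |a b c. is_triangle T a b c}"

definition triangle_sides :: "(real^2) set \<Rightarrow> real set" where
  "triangle_sides T = {dist a b |a b c. is_triangle T a b c}"

definition triangle_diam :: "(real^2) set \<Rightarrow> real" where
  "triangle_diam T = Max (triangle_sides T)"

definition triangle_area :: "(real^2) set \<Rightarrow> real" where
  "triangle_area T = measure lebesgue T"


section \<open>Two-dimensional continued fraction expansions\<close>

text \<open>Row \<open>i\<close> of an integer matrix \<open>M\<close> is \<open>(p\<^sub>i, q\<^sub>i, d\<^sub>i)\<close>; it encodes the rational
  point \<open>(p\<^sub>i / d\<^sub>i, q\<^sub>i / d\<^sub>i)\<close>.\<close>

definition denom :: "int^3^3 \<Rightarrow> 3 \<Rightarrow> int" where
  "denom M i = M $ i $ 3"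

definition vertex :: "int^3^3 \<Rightarrow> 3 \<Rightarrow> real^2" where
  "vertex M i = vector [of_int (M $ i $ 1) / of_int (denom M i),
                        of_int (M $ i $ 2) / of_int (denom M i)]"

definition unimodular_coords :: "(real^2) set \<Rightarrow> int^3^3 \<Rightarrow> bool" where
  "unimodular_coords T M \<longleftrightarrow>
     (\<forall>i. denom M i > 0) \<and> is_triangle T (vertex M 1) (vertex M 2) (vertex M 3) \<and>
     (det M = 1 \<or> det M = - 1)"

definition rational_points :: "(real^2) set" where
  "rational_points = {x. x $ 1 \<in> \<rat> \<and> x $ 2 \<in> \<rat>}"

text \<open>Values of \<open>\<mu>\<close> at rational points are irrelevant.  The
  triangles are not required to be nested or distinct.\<close>

definition cf_expansion :: "(real^2 \<Rightarrow> nat \<Rightarrow> (real^2) set) \<Rightarrow> bool" where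
  "cf_expansion \<mu> \<longleftrightarrow>
     (\<forall>x. x \<notin> rational_points \<longrightarrow>
        (\<forall>n. \<exists>M. unimodular_coords (\<mu> x n) M) \<and> (\<Inter>n. \<mu> x n) = {x})"

end

theory Submission
  imports Defs
begin

text \<open>
  Let \<open>\<phi>\<close> be the real root of \<open>X\<^sup>3 + X\<^sup>2 = 1\<close> (the inverse of the plastic number), a unit of the cubic field
  of discriminant -23. The points \<open>x = (\<phi>\<^sup>2 + m, \<phi>)\<close> with \<open>m\<close> an integer have the required property, and in
  fact no unimodular triangle containing such an \<open>x\<close> has \<open>diam\<^sup>2 < 4 (13/23)\<^sup>1\<^sup>/\<^sup>2 area\<close>. A triangle all of whose
  angles exceed \<open>arcsin (23\<^sup>1\<^sup>/\<^sup>2 / 6)\<close> is fat in this sense, since the cotangents of these angles are below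
  \<open>(13/23)\<^sup>1\<^sup>/\<^sup>2\<close> and a side is the altitude on it times the sum of the cotangents at its ends.

  The three edges of a unimodular triangle are integral linear forms. Evaluated at \<open>(x, 1)\<close> they are positive
  elements of the ring of integers with weighted sum 1, and their norms are positive integers. The squared
  modulus of the complex conjugate of such an element is close to a positive definite quadratic form of
  determinant 23/4 in the edge vector, which is nearly Euclidean. For a fat triangle the product of the three
  norms is therefore too small unless all norms are 1, so that the three elements are powers of \<open>\<phi>\<close>. Fatness also
  bounds the differences of their exponents, and the remaining patterns of exponents are excluded one by one.
\<close>

section \<open>The real root of the cubic\<close>

lemma phi_exists: "\<exists>x::real. 0.754877 \<le> x \<and> x \<le> 0.754878 \<and> x^3 + x^2 = 1"
proof -
  have "continuous_on {0.754877..0.754878} (\<lambda>x::real. x^3 + x^2)"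
    by (intro continuous_intros)
  then show ?thesis
    using IVT'[of "\<lambda>x::real. x^3 + x^2" "0.754877" 1 "0.754878"]
    by (force simp: power_divide)
qed

definition phi :: real where
  "phi = (SOME x. 0.754877 \<le> x \<and> x \<le> 0.754878 \<and> x^3 + x^2 = 1)"

lemma phi_lb: "0.754877 \<le> phi" and phi_ub: "phi \<le> 0.754878" and phi_eq: "phi^3 + phi^2 = 1"
  using someI_ex[OF phi_exists] unfolding phi_def by blast+

section \<open>The norm form of the cubic field of discriminant -23\<close>

text \<open>With \<open>\<phi>'\<close> a complex conjugate of \<open>\<phi>\<close>, \<open>psi a b c\<close> is the real number \<open>|a \<phi>'\<^sup>2 + b \<phi>' + c|\<^sup>2\<close>, so
  that \<open>lin * psi\<close> is the norm \<open>nrm\<close>. The form \<open>qf a b\<close> is the value of \<open>psi\<close> at the real \<open>c\<close> with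
  \<open>a \<phi>\<^sup>2 + b \<phi> + c = 0\<close>, and \<open>lin_coeff\<close> is the coefficient of \<open>lin\<close> when \<open>psi\<close> is expanded around it.\<close>

definition lin :: "int \<Rightarrow> int \<Rightarrow> int \<Rightarrow> real" where
  "lin a b c = a * phi^2 + b * phi + c"

definition psi :: "int \<Rightarrow> int \<Rightarrow> int \<Rightarrow> real" where
  "psi a b c = a^2 * (phi^2+phi)^2 + b^2 * (phi^2+phi) + c^2 - a*b*(phi^2+phi)*(1+phi)
     + a*c*((1+phi)^2 - 2*(phi^2+phi)) - b*c*(1+phi)"

text \<open>Minus the determinant of the coordinate rows of the element, of \<open>phi\<close> times
  it and of \<open>phi^2\<close> times it; the sign comes from the basis order \<open>phi^2\<close>,
  \<open>phi\<close>, 1.\<close>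

definition nrm :: "int \<Rightarrow> int \<Rightarrow> int \<Rightarrow> int" where
  "nrm a b c = - (a*(c*(b-a) - a^2) - b*((b-a)^2 - a*(c-b+a)) + c*((b-a)*a - c*(c-b+a)))"

definition qf :: "int \<Rightarrow> int \<Rightarrow> real" where
  "qf a b = (3*phi^2+2*phi) * (phi^2*a^2 - (1-phi)*a*b + b^2)"

definition lin_coeff :: "int \<Rightarrow> int \<Rightarrow> real" where
  "lin_coeff a b = a*((1+phi)^2 - 2*(phi^2+phi) - 2*phi^2) - b*(1+3*phi)"

text \<open>The complex conjugates of \<open>phi\<close> have sum \<open>-(1+phi)\<close> and
  product \<open>phi^2+phi\<close>; expanding with these values gives \<open>psi\<close>, and the
  product with \<open>lin\<close> is reduced modulo the cubic.\<close>

lemma nrm_eq: "real_of_int (nrm a b c) = lin a b c * psi a b c"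
  unfolding nrm_def lin_def psi_def using phi_eq by simp algebra

lemma psi_eq: "psi a b c = (lin a b c)^2 + lin a b c * lin_coeff a b + qf a b"
  unfolding lin_def psi_def lin_coeff_def qf_def of_int_power by algebra

text \<open>By \<open>psi_eq\<close>, \<open>psi\<close> is |t + w|^2 with t the value of
  \<open>lin\<close> and w = a (phi'^2 - phi^2) + b (phi' - phi). So \<open>lin_coeff\<close> is 2
  Re w, \<open>qf\<close> is |w|^2, and the right side is 4 (Im w)^2.\<close>

lemma lin_coeff_qf: "4 * qf a b - (lin_coeff a b)^2 = (4*(phi^2+phi) - (1+phi)^2) * (b - a*(1+phi))^2"
  unfolding lin_coeff_def qf_def of_int_power by algebra

text \<open>This is 4AC - B^2 for the binary form \<open>qf\<close>, whose factor
  \<open>3*phi^2+2*phi\<close> is the derivative of the cubic at \<open>phi\<close>.\<close>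

lemma disc: "(3*phi^2+2*phi)^2 * (4*phi^2 - (1-phi)^2) = 23"
  using phi_eq by algebra

lemma lin_shift: "phi * lin a b c = lin (b-a) c a"
  unfolding lin_def of_int_diff using phi_eq by algebra

lemma nrm_shift: "nrm (b-a) c a = nrm a b c"
  unfolding nrm_def by algebra

text \<open>The prime 2 is inert, since X^3 + X^2 - 1 has no root modulo 2.\<close>

lemma even_nrm: assumes "even (nrm a b c)" shows "even a \<and> even b \<and> even c"
  using assms unfolding nrm_def by auto

text \<open>The prime 3 is inert too; the norm modulo 3 depends on residues only, which leaves 27
  cases.\<close>

lemma three_dvd_nrm: assumes "3 dvd (nrm a b c)" shows "3 dvd a \<and> 3 dvd b \<and> 3 dvd c"
proof -
  have eq: "nrm (3*i+u) (3*j+v) (3*k+w) mod 3 = nrm u v w mod 3" for i j k u v w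
  proof -
    have "3 dvd nrm (3*i+u) (3*j+v) (3*k+w) - nrm u v w"
      unfolding nrm_def by (simp add: algebra_simps power2_eq_square)
    thus ?thesis by (simp add: mod_eq_dvd_iff)
  qed
  have "nrm (a mod 3) (b mod 3) (c mod 3) mod 3 = 0"
    using assms eq[of "a div 3" "a mod 3" "b div 3" "b mod 3" "c div 3" "c mod 3"] by simp
  moreover have "a mod 3 \<in> {0,1,2}" "b mod 3 \<in> {0,1,2}" "c mod 3 \<in> {0,1,2}" by auto
  ultimately show ?thesis by (auto simp: nrm_def)
qed

section \<open>Numerical estimates for \<open>phi\<close> and the form \<open>qf\<close>\<close>

lemma phi_sq_bounds: "0.569839 \<le> phi^2" "phi^2 \<le> 0.569841"
proof -
  have "0.754877^2 \<le> phi^2" using phi_lb by (intro power_mono) auto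
  thus "0.569839 \<le> phi^2" by (simp add: power2_eq_square)
  have "phi^2 \<le> 0.754878^2" using phi_ub phi_lb by (intro power_mono) auto
  thus "phi^2 \<le> 0.569841" by (simp add: power2_eq_square)
qed

lemma quadratic_form_nonneg: fixes x y a b c :: real
  assumes "a > 0" "b^2 \<le> 4*(a*c)"
  shows "0 \<le> a*x^2 + b*x*y + c*y^2"
proof -
  have "4*a*(a*x^2 + b*x*y + c*y^2) = (2*a*x+b*y)^2 + (4*(a*c)-b^2)*y^2" by algebra
  also have "\<dots> \<ge> 0" using assms by simp
  finally show ?thesis using assms by (simp add: zero_le_mult_iff)
qed

lemma c0_bounds: "3.219271 \<le> 3*phi^2+2*phi" "3*phi^2+2*phi \<le> 3.219279"
  using phi_sq_bounds phi_lb phi_ub by linarith+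

lemma coef_bounds:
  "1.834461 \<le> (3*phi^2+2*phi)*phi^2" "(3*phi^2+2*phi)*phi^2 \<le> 1.834478"
  "0 \<le> (3*phi^2+2*phi)*(1-phi)" "((3*phi^2+2*phi)*(1-phi))^2 \<le> 0.622722"
proof -
  have "3.219271 * 0.569839 \<le> (3*phi^2+2*phi)*phi^2"
    using c0_bounds phi_sq_bounds by (intro mult_mono) auto
  thus "1.834461 \<le> (3*phi^2+2*phi)*phi^2" by simp
  have "(3*phi^2+2*phi)*phi^2 \<le> 3.219279 * 0.569841"
    using c0_bounds phi_sq_bounds by (intro mult_mono) auto
  thus "(3*phi^2+2*phi)*phi^2 \<le> 1.834478" by simp
  show 1: "0 \<le> (3*phi^2+2*phi)*(1-phi)"
    using c0_bounds phi_ub by (intro mult_nonneg_nonneg) auto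
  have "(3*phi^2+2*phi)*(1-phi) \<le> 3.219279 * 0.245123"
    using c0_bounds phi_lb phi_ub by (intro mult_mono) auto
  hence "(3*phi^2+2*phi)*(1-phi) \<le> 0.789120" by simp
  hence "((3*phi^2+2*phi)*(1-phi))^2 \<le> 0.789120^2" using 1 by (intro power_mono) auto
  thus "((3*phi^2+2*phi)*(1-phi))^2 \<le> 0.622722" by (simp add: power2_eq_square)
qed

lemma le_4_trans: "s \<le> w \<Longrightarrow> u \<le> p \<Longrightarrow> w \<le> 4 * u \<Longrightarrow> s \<le> 4 * p" for s w u p :: real
  by linarith

text \<open>The constant lies just above the larger eigenvalue of \<open>qf\<close>, about
  3.3238.\<close>

lemma qf_le: "qf a b \<le> 3.3245 * (a^2+b^2)"
proof -
  let ?c = "3*phi^2+2*phi"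
  have "1.490022 * 0.105221 \<le> (3.3245 - ?c*phi^2) * (3.3245 - ?c)"
    using coef_bounds c0_bounds by (intro mult_mono) auto
  hence "(?c*(1-phi))^2 \<le> 4 * ((3.3245 - ?c*phi^2) * (3.3245 - ?c))"
    by (intro le_4_trans[OF coef_bounds(4)]) auto
  hence "0 \<le> (3.3245 - ?c*phi^2)*(real_of_int a)^2 + (?c*(1-phi))*a*b + (3.3245 - ?c)*(real_of_int b)^2"
    using coef_bounds by (intro quadratic_form_nonneg) auto
  thus ?thesis unfolding qf_def by (simp add: algebra_simps)
qed

text \<open>For D the product of the denominators, 1/D is twice the area, and 1.50362 rounds up 2
  (13/23)^(1/2); so the hypothesis is fatness of one side. The 5 comes from 3.3245 * 1.50362 <
  5.\<close>

lemma fat_qf: fixes d D a b :: int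
  assumes "d^2 * (a^2+b^2) \<le> 1.50362 * D" "0 < D"
  shows "(real_of_int d)^2 * qf a b \<le> 5 * real_of_int D"
proof -
  have "(real_of_int d)^2 * qf a b \<le> (real_of_int d)^2 * (3.3245*(a^2+b^2))"
    using qf_le by (intro mult_left_mono) auto
  also have "\<dots> = 3.3245 * (d^2*(a^2+b^2))" by simp
  also have "\<dots> \<le> 3.3245 * (1.50362*real_of_int D)" using assms(1) by (intro mult_left_mono) auto
  also have "\<dots> \<le> 5 * real_of_int D" using assms(2) by simp
  finally show ?thesis .
qed

lemma qf_ge: "qf a b \<ge> 1.7 * (a^2+b^2)"
proof -
  let ?c = "3*phi^2+2*phi"
  have "0.134461 * 1.519271 \<le> (?c*phi^2 - 1.7) * (?c - 1.7)"
    using coef_bounds c0_bounds by (intro mult_mono) auto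
  hence "(- (?c*(1-phi)))^2 \<le> 4 * ((?c*phi^2 - 1.7) * (?c - 1.7))"
    unfolding power2_minus by (intro le_4_trans[OF coef_bounds(4)]) auto
  hence "0 \<le> (?c*phi^2 - 1.7)*(real_of_int a)^2 + (- (?c*(1-phi)))*a*b + (?c - 1.7)*(real_of_int b)^2"
    using coef_bounds by (intro quadratic_form_nonneg) auto
  thus ?thesis unfolding qf_def by (simp add: algebra_simps)
qed

lemma qf_nonneg: "qf a b \<ge> 0"
proof -
  have "0 \<le> 1.7 * ((real_of_int a)^2+(real_of_int b)^2)" by simp
  thus ?thesis using qf_ge[of a b] by linarith
qed

lemma abs_lin_coeff_le: "\<bar>lin_coeff a b\<bar> \<le> 2 * sqrt (qf a b)"
proof -
  have "(1+phi)^2 \<le> 4*(phi^2+phi)"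
    using phi_sq_bounds phi_lb by (simp add: power2_eq_square algebra_simps)
  hence "0 \<le> 4 * qf a b - (lin_coeff a b)^2" unfolding lin_coeff_qf by simp
  hence "(lin_coeff a b)^2 \<le> (2 * sqrt (qf a b))^2" using qf_nonneg[of a b] by (simp add: power_mult_distrib)
  thus ?thesis using qf_nonneg[of a b] abs_le_square_iff[of "lin_coeff a b" "2 * sqrt (qf a b)"] by simp
qed

text \<open>Triangle inequality for |t + w| as in \<open>lin_coeff_qf\<close>; \<open>psi_ge\<close>
  is the reverse inequality.\<close>

lemma psi_le: assumes "0 \<le> lin a b c" shows "psi a b c \<le> (lin a b c + sqrt (qf a b))^2"
proof -
  have "lin a b c * lin_coeff a b \<le> lin a b c * (2 * sqrt (qf a b))"
    using abs_lin_coeff_le[of a b] assms by (intro mult_left_mono) auto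
  thus ?thesis using qf_nonneg[of a b] unfolding psi_eq by (simp add: power2_sum)
qed

lemma psi_ge: assumes "0 \<le> lin a b c" shows "(lin a b c - sqrt (qf a b))^2 \<le> psi a b c"
proof -
  have "lin a b c * (- (2 * sqrt (qf a b))) \<le> lin a b c * lin_coeff a b"
    using abs_lin_coeff_le[of a b] assms by (intro mult_left_mono) auto
  thus ?thesis using qf_nonneg[of a b] unfolding psi_eq by (simp add: power2_diff)
qed

lemma sqrt_qf_ge: assumes "0 \<le> lin a b c" shows "sqrt (psi a b c) - lin a b c \<le> sqrt (qf a b)"
proof -
  have "sqrt (psi a b c) \<le> lin a b c + sqrt (qf a b)"
    using psi_le[OF assms] assms qf_nonneg[of a b] by (intro real_le_lsqrt) auto
  thus ?thesis by simp
qed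

text \<open>The norm is nonnegative because \<open>psi\<close> is, and prime to 6 because 2 and 3
  are inert.\<close>

lemma nrm_eq_1_or_ge_5: assumes "0 < lin a b c" "\<not> (even a \<and> even b \<and> even c)"
  "\<not> (3 dvd a \<and> 3 dvd b \<and> 3 dvd c)"
  shows "nrm a b c = 1 \<or> nrm a b c \<ge> 5"
proof -
  have "0 \<le> psi a b c" using psi_ge[of a b c] assms(1) by (meson order_trans zero_le_power2 less_imp_le)
  hence "0 \<le> real_of_int (nrm a b c)" unfolding nrm_eq using assms(1) by simp
  hence "0 \<le> nrm a b c" by linarith
  moreover have "odd (nrm a b c)" "\<not> 3 dvd nrm a b c" using assms even_nrm three_dvd_nrm by blast+
  ultimately show ?thesis by presburger
qed

section \<open>Inequalities for products of three numbers\<close>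

lemma amgm3: fixes x y z :: real assumes "0 \<le> x" "0 \<le> y" "0 \<le> z"
  shows "x*y*z \<le> ((x+y+z)/3)^3"
proof -
  have "27 * (((x+y+z)/3)^3 - x*y*z) = (x+y+z)^3 - 27*x*y*z" by (simp add: power_divide)
  also have "\<dots> = (x+y+z)*((x-y)^2+(y-z)^2+(z-x)^2)/2 + 3*(x*(y-z)^2+y*(z-x)^2+z*(x-y)^2)" by algebra
  also have "\<dots> \<ge> 0" using assms by simp
  finally show ?thesis by simp
qed

text \<open>The equation is Heron's formula for a triangle with squared sides \<open>p, q, r\<close> and squared area
  \<open>23/16\<close>.\<close>

lemma heron_prod_aux: fixes p q r :: real
  assumes "0 < p" "p \<le> 5" "q \<le> p" "r \<le> p" "0 < q" "0 < r" and h: "4*q*r - (p-q-r)^2 = 23"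
  shows "p*q*r \<le> 32"
proof -
  \<comment> \<open>Law of cosines: \<open>y\<close> is twice the product of the two shorter sides
    and the cosine of the largest angle. As 4qr = 23 + y^2, the goal becomes p (23 + y^2) \<le>
    128.\<close>
  define y where "y = q + r - p"
  have yp: "y \<le> p" using assms by (simp add: y_def)
  have qr: "4*q*r = 23 + y^2" using h by (simp add: y_def power2_eq_square algebra_simps)
  have "0 \<le> (p-q)*(p-r)" using assms by simp
  hence "p*y \<le> q*r" by (simp add: y_def algebra_simps)
  hence 1: "4*p*y \<le> 23 + y^2" using qr by linarith
  have "y \<ge> - 0.2"
  proof (rule ccontr)
    assume "\<not> ?thesis" hence "y < -0.2" by simp
    have "4*q*r \<le> (q+r)^2" using sum_squares_ge_zero[of "q-r" 0] by (simp add: power2_eq_square algebra_simps)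
    hence "23 + y^2 \<le> (y+p)^2" using qr by (simp add: y_def)
    hence a: "23 \<le> p*(2*y+p)" by (simp add: power2_eq_square algebra_simps)
    have "p*(2*y+p) \<le> p * 4.6" using \<open>y < _\<close> assms by (intro mult_left_mono) auto
    moreover have "2*y+p < 4.6" using \<open>y < _\<close> assms by linarith
    hence "p*(2*y+p) < p*4.6" using assms by (intro mult_strict_left_mono) auto
    ultimately show False using a assms by linarith
  qed
  have "p*(23+y^2) \<le> 128"
  proof (cases "y \<le> 0")
    case True
    hence "y^2 \<le> 0.2^2" using \<open>y \<ge> _\<close> abs_le_square_iff[of y "0.2"] by simp
    hence "p*(23+y^2) \<le> 5*(23+0.04)" using assms by (intro mult_mono) (auto simp: power2_eq_square)
    thus ?thesis by simp
  next
    case False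
    \<comment> \<open>For an acute angle, y \<le> p and 4py \<le> 23 + y^2 give y \<le> 23/(3p),
      which leaves a quadratic inequality in p alone.\<close>
    have "y*y \<le> p*y" using yp False by simp
    hence 2: "3*p*y \<le> 23" using 1 by (simp add: power2_eq_square)
    have y2: "9*p*(p*y^2) \<le> 529" using power_mono[OF 2, of 2] assms False by (simp add: power2_eq_square algebra_simps)
    have p: "p^2 \<ge> 23/3"
    proof -
      have "q*r \<le> p*p" using assms by (intro mult_mono) auto
      have "23 + y^2 \<le> (y+p)^2"
        using qr sum_squares_ge_zero[of "q-r" 0] by (simp add: y_def power2_eq_square algebra_simps)
      hence "23 \<le> 2*p*y + p^2" by (simp add: power2_eq_square algebra_simps)
      also have "\<dots> \<le> 2*p*p + p^2" using yp assms by simp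
      finally show ?thesis by (simp add: power2_eq_square)
    qed
    have p2: "p \<ge> 2.7"
    proof (rule ccontr)
      assume "\<not> ?thesis" hence "p^2 \<le> 2.7^2" using assms by (intro power_mono) auto
      thus False using p by (simp add: power2_eq_square)
    qed
    have "9*p*(p*(23+y^2)) \<le> 207*p^2 + 529" using y2 by (simp add: algebra_simps power2_eq_square)
    also have "\<dots> \<le> 9*p*128"
    proof -
      have "(p-5)*(207*p - 117) \<le> 0" using p2 assms by (intro mult_nonpos_nonneg) auto
      moreover have "9*p*128 - (207*p^2 + 529) = -((p-5)*(207*p - 117)) + 56 - 0*p"
        by (simp add: algebra_simps power2_eq_square)
      ultimately show ?thesis by linarith
    qed
    finally show ?thesis using assms by simp
  qed
  moreover have "4*(p*q*r) = p*(23+y^2)" using qr by (simp add: algebra_simps)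
  ultimately show ?thesis by linarith
qed

text \<open>The Heron condition is symmetric, so any of the three may be the largest. It also gives
  23 \<le> 4uy \<le> 20u for two of them, whence 1.15 = 23/20.\<close>

lemma heron_prod: fixes p q r :: real
  assumes "p \<le> 5" "q \<le> 5" "r \<le> 5" "0 < p" "0 < q" "0 < r"
    and h: "4*q*r - (p-q-r)^2 = 23"
  shows "p*q*r \<le> 32" "1.15 \<le> p" "1.15 \<le> q" "1.15 \<le> r"
proof -
  have h2: "4*p*r - (q-p-r)^2 = 23" and h3: "4*p*q - (r-p-q)^2 = 23"
    using h by (simp_all add: power2_eq_square algebra_simps)
  show "p*q*r \<le> 32"
  proof -
    consider "q \<le> p \<and> r \<le> p" | "p \<le> q \<and> r \<le> q" | "p \<le> r \<and> q \<le> r" by linarith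
    thus ?thesis
    proof cases
      case 1 thus ?thesis using heron_prod_aux[of p q r] assms by auto
    next
      case 2 thus ?thesis using heron_prod_aux[of q p r] assms h2 by (auto simp: mult.commute)
    next
      case 3 thus ?thesis using heron_prod_aux[of r p q] assms h3 by (auto simp: mult_ac)
    qed
  qed
  have *: "1.15 \<le> (u::real)" if "4*u*y - w\<^sup>2 = 23" "y \<le> 5" "0 < y" "0<u" for u y w
  proof -
    have "23 \<le> 4*u*y" using that(1) zero_le_power2[of w] by linarith
    also have "\<dots> \<le> 4*u*5" using that by (intro mult_left_mono) auto
    finally show ?thesis by simp
  qed
  show "1.15 \<le> q" "1.15 \<le> p" using * assms h h2 by blast+
  show "1.15 \<le> r" using *[of r q "p-q-r"] h assms by (simp add: mult_ac)
qed

section \<open>Units\<close>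

text \<open>The coordinates of \<open>\<phi>\<^sup>k\<close> with respect to \<open>\<phi>\<^sup>2, \<phi>, 1\<close> are three terms of a single sequence.\<close>

fun ucoord :: "nat \<Rightarrow> int" where
  "ucoord 0 = 0"
| "ucoord (Suc 0) = 1"
| "ucoord (Suc (Suc 0)) = 0"
| "ucoord (Suc (Suc (Suc n))) = ucoord n - ucoord (Suc (Suc n))"

lemma lin_unit: "lin (ucoord (k+2)) (ucoord k) (ucoord (k+1)) = phi^k"
proof (induction k)
  case 0
  then show ?case by (simp add: lin_def)
next
  case (Suc k)
  show ?case using lin_shift[of "ucoord (k+2)" "ucoord k" "ucoord (k+1)"] Suc by simp
qed

lemma nrm_unit: "nrm (ucoord (k+2)) (ucoord k) (ucoord (k+1)) = 1"
proof (induction k)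
  case 0
  then show ?case by (simp add: nrm_def)
next
  case (Suc k)
  show ?case using nrm_shift[of "ucoord k" "ucoord (k+2)" "ucoord (k+1)"] Suc by simp
qed

lemma int_sq_le_1: fixes a :: int assumes "a^2 \<le> 3" shows "a \<in> {-1,0,1}"
proof -
  have "\<bar>a\<bar> < 2" using assms power_mono[of 2 "\<bar>a\<bar>" 2] by (cases "\<bar>a\<bar> < 2") auto
  thus ?thesis by auto
qed

lemma small_units: "\<forall>a\<in>{-1,0,1}. \<forall>b\<in>{-1,0,1}. \<forall>c\<in>{0,1,2}. nrm a b c = 1 \<longrightarrow> (a,b,c) \<in> {(-1,0,1),(-1,1,0),(0,-1,1),(0,0,1),(0,1,0),(0,1,1),(1,0,0),(1,1,0),(1,1,1)}"
  by (simp add: nrm_def)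

text \<open>The interval from 1 to 1/phi is a fundamental domain for multiplication by
  \<open>phi\<close>. On it, norm 1 forces \<open>psi\<close> to be at most 1, hence the root of
  \<open>qf\<close> to be at most 1 + \<open>lin\<close>, and \<open>qf_ge\<close> leaves few
  coefficients.\<close>

lemma unit_base: assumes n: "nrm a b c = 1" and l: "1 \<le> lin a b c" and u: "phi * lin a b c < 1"
  shows "a = 0 \<and> b = 0 \<and> c = 1"
proof -
  let ?t = "lin a b c"
  have t: "?t < 1.325"
  proof (rule ccontr)
    assume "\<not> ?thesis"
    hence "0.754877 * 1.325 \<le> phi * ?t" using phi_lb by (intro mult_mono) auto
    thus False using u by simp
  qed
  have tp: "?t * psi a b c = 1" using nrm_eq[of a b c] n by simp
  have psi0: "0 \<le> psi a b c" using psi_ge[of a b c] l by (meson order_trans zero_le_power2 zero_le_one)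
  have "psi a b c \<le> ?t * psi a b c" using l psi0 by (simp add: mult_le_cancel_right1)
  hence "(?t - sqrt (qf a b))^2 \<le> 1^2" using psi_ge[of a b c] l tp by simp
  hence "\<bar>?t - sqrt (qf a b)\<bar> \<le> 1" using abs_le_square_iff[of "?t - sqrt (qf a b)" 1] by simp
  hence "sqrt (qf a b) \<le> 2.325" using t unfolding abs_le_iff by simp
  hence "(sqrt (qf a b))^2 \<le> 2.325^2" using qf_nonneg by (intro power_mono) auto
  hence "qf a b \<le> 5.41" using qf_nonneg[of a b] by (simp add: power2_eq_square)
  hence "(real_of_int a)^2 + (real_of_int b)^2 \<le> 3.9" using qf_ge[of a b] by simp
  hence "real_of_int (a^2+b^2) < 4" by simp
  hence s: "a^2 + b^2 < 4" by linarith
  have "a^2 \<le> 3" "b^2 \<le> 3" using s zero_le_power2[of a] zero_le_power2[of b] by linarith+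
  hence ab: "a \<in> {-1,0,1}" "b \<in> {-1,0,1}" using int_sq_le_1 by blast+
  have c: "c \<in> {0,1,2}"
  proof -
    have c': "real_of_int c = ?t - a*phi^2 - b*phi" by (simp add: lin_def)
    have *: "\<bar>x * y\<bar> \<le> z" if "x \<in> {-1,0,1}" "0 \<le> y" "y \<le> z" for x y z :: real
      using that by auto
    have "real_of_int a \<in> {-1,0,1}" "real_of_int b \<in> {-1,0,1}" using ab by auto
    hence "\<bar>a * phi^2\<bar> \<le> 57/100" "\<bar>b * phi\<bar> \<le> 76/100"
      using phi_sq_bounds phi_lb phi_ub by (intro *; simp)+
    moreover have "?t \<le> 133/100" using t by simp
    ultimately have "real_of_int c < 3" "real_of_int c > -1" using c' l by linarith+
    thus ?thesis by auto
  qed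
  have fin: "(a,b,c) \<in> {(-1,0,1),(-1,1,0),(0,-1,1),(0,0,1),(0,1,0),(0,1,1),(1,0,0),(1,1,0),(1,1,1)}" by (rule small_units[rule_format, OF ab c n])
  \<comment> \<open>The unit \<open>lin 1 1 0\<close> is exactly 1/phi, the open end of the
    interval, so it is excluded by an identity and not by an estimate.\<close>
  have "phi * (phi^2 + phi) = 1" using phi_eq by (simp add: power2_eq_square power3_eq_cube algebra_simps)
  moreover have "lin 1 1 0 = phi^2 + phi" by (simp add: lin_def)
  ultimately have "(a,b,c) \<noteq> (1,1,0)" using u by (metis less_irrefl prod.inject)
  moreover have "1 \<le> lin a b c \<and> lin a b c < 1.325" using l t by simp
  ultimately have ne: "(a,b,c) \<noteq> (1,1,0)" "1 \<le> lin a b c" "lin a b c \<le> 133/100" by auto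
  consider "(a,b,c) = (0,0,1)" | "(a,b,c) \<in> {(-1,0,1),(-1,1,0),(0,-1,1),(0,1,0),(1,0,0)}"
    | "(a,b,c) \<in> {(0,1,1),(1,1,1)}"
    using fin ne(1) by (elim insertE) blast+
  thus ?thesis
  proof cases
    case 2
    hence "lin a b c < 1" using phi_lb phi_ub phi_sq_bounds by (elim insertE) (simp_all add: lin_def)
    thus ?thesis using ne by linarith
  next
    case 3
    hence "lin a b c > 133/100" using phi_lb phi_ub phi_sq_bounds by (elim insertE) (simp_all add: lin_def)
    thus ?thesis using ne by linarith
  qed simp
qed

text \<open>Division by \<open>phi\<close> keeps the norm and lowers the exponent by one; the
  quotient has coordinates \<open>(c, a+c, b)\<close>.\<close>

lemma unit_interval: assumes "nrm a b c = 1" "phi^k \<le> lin a b c" "phi * lin a b c < phi^k"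
  shows "a = ucoord (k+2) \<and> b = ucoord k \<and> c = ucoord (k+1)"
  using assms
proof (induction k arbitrary: a b c)
  case 0
  then show ?case using unit_base[of a b c] by simp
next
  case (Suc k)
  have l: "lin a b c = phi * lin c (a+c) b" using lin_shift[of c "a+c" b] by simp
  have p: "phi > 0" using phi_lb by simp
  have "nrm c (a+c) b = 1" using nrm_shift[of "a+c" c b] Suc.prems by simp
  moreover have "phi^k \<le> lin c (a+c) b" "phi * lin c (a+c) b < phi^k"
    using Suc.prems p unfolding l by auto
  ultimately have "c = ucoord (k+2) \<and> a+c = ucoord k \<and> b = ucoord (k+1)" using Suc.IH by blast
  then show ?case by simp
qed

text \<open>An element of (0, 1) lies between two consecutive powers of \<open>phi\<close>, so
  \<open>unit_interval\<close> identifies it: \<open>phi\<close> is a fundamental unit.\<close>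

lemma unit_classification: assumes "nrm a b c = 1" "0 < lin a b c" "lin a b c < 1"
  obtains k where "k \<ge> 1" "a = ucoord (k+2)" "b = ucoord k" "c = ucoord (k+1)"
proof -
  have p: "0 < phi" "phi < 1" using phi_lb phi_ub by auto
  obtain n where n: "phi^n < lin a b c" using real_arch_pow_inv[OF assms(2) p(2)] by blast
  define P where "P = (\<lambda>k. phi^k \<le> lin a b c)"
  have "P n" using n by (simp add: P_def)
  moreover have "\<not> P 0" using assms(3) by (simp add: P_def)
  ultimately obtain k where "\<not> P k" "P (Suc k)" using ex_least_nat_less[of P n] by blast
  hence k: "phi^Suc k \<le> lin a b c" "lin a b c < phi^k" by (simp_all add: P_def)
  have "phi * lin a b c < phi^Suc k" using k(2) p by simp
  from unit_interval[OF assms(1) k(1) this] show ?thesis using that[of "Suc k"] by simp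
qed

section \<open>All norms of a fat triple are 1\<close>

lemma qf_scale: "qf (d*a) (d*b) = (real_of_int d)^2 * qf a b"
  unfolding qf_def by (simp add: algebra_simps power2_eq_square)

text \<open>Heron's formula in the metric \<open>qf\<close>, of Gram determinant 23/4: both sides
  are 16 times the squared area of the triangle on the two vectors.\<close>

lemma qf_heron: "4 * qf a b * qf a' b' - (qf (a+a') (b+b') - qf a b - qf a' b')^2
   = 23 * (real_of_int (a*b' - b*a'))^2"
proof -
  have "4 * qf a b * qf a' b' - (qf (a+a') (b+b') - qf a b - qf a' b')^2
    = ((3*phi^2+2*phi)^2 * (4*phi^2 - (1-phi)^2)) * (real_of_int (a*b' - b*a'))^2"
    unfolding qf_def of_int_add of_int_diff of_int_mult of_int_power by algebra
  thus ?thesis unfolding disc .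
qed

text \<open>The left side is \<open>(d * lin) * (d^2 * psi)\<close>, to which \<open>psi_le\<close>
  applies. As \<open>sqrt D * y\<close> is at least 1.4142 * 1.0723 > 1/0.66, the summand
  \<open>d * lin\<close> is absorbed by the factor \<open>1 + 0.66 * (d * lin)\<close>.\<close>

lemma nrm_le_term: fixes d r :: real
  assumes "0 < lin a b c" "0 < d" "0 < D" and y: "y = d * sqrt (qf a b) / sqrt D"
    and y1: "1.0723 \<le> y" and D2: "2 \<le> D"
  shows "d^3 * nrm a b c \<le> D * ((d * lin a b c) * y^2 * (1 + 0.66 * (d * lin a b c))^2)"
proof -
  let ?t = "lin a b c" and ?b = "d * lin a b c"
  have b0: "0 < ?b" using assms by simp
  have "1.4142^2 \<le> D" using D2 by (simp add: power2_eq_square)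
  hence sD: "1.4142 \<le> sqrt D" using real_le_rsqrt by blast
  have "d^3 * nrm a b c = ?b * (d^2 * psi a b c)" by (simp add: nrm_eq power3_eq_cube power2_eq_square)
  also have "\<dots> \<le> ?b * (d^2 * (?t + sqrt (qf a b))^2)"
    using psi_le[of a b c] assms b0 by (intro mult_left_mono) auto
  also have "\<dots> = ?b * (?b + d * sqrt (qf a b))^2" by (simp add: power2_eq_square algebra_simps)
  also have "\<dots> \<le> ?b * (sqrt D * (y * (1 + 0.66 * ?b)))^2"
  proof (intro mult_left_mono power_mono)
    have "d * sqrt (qf a b) = sqrt D * y" using y assms by simp
    moreover have "1.4142 * 1.0723 \<le> sqrt D * y" using sD y1 assms(3) by (intro mult_mono) auto
    hence "1 \<le> sqrt D * y * 0.66" by simp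
    hence "?b * 1 \<le> ?b * (sqrt D * y * 0.66)" using b0 by (intro mult_left_mono) auto
    ultimately show "?b + d * sqrt (qf a b) \<le> sqrt D * (y * (1 + 0.66 * ?b))"
      by (simp add: algebra_simps)
  next
    show "0 \<le> ?b" "0 \<le> ?b + d * sqrt (qf a b)" using b0 assms qf_nonneg[of a b] by simp_all
  qed
  also have "\<dots> = D * (?b * y^2 * (1 + 0.66 * ?b)^2)"
    using assms(3) by (simp add: power_mult_distrib)
  finally show ?thesis .
qed

text \<open>AM-GM for the \<open>b\<close>s and again for the factors \<open>1 + 0.66 * b\<close>,
  whose mean is 1.22; (32/27) * 1.22^6 is about 3.91.\<close>

lemma norm_prod_bound: fixes b1 b2 b3 y1 y2 y3 :: real
  assumes "0 < b1" "0 < b2" "0 < b3" "b1 + b2 + b3 = 1" "y1^2*y2^2*y3^2 \<le> 32"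
  shows "(b1*y1^2*(1+0.66*b1)^2) * (b2*y2^2*(1+0.66*b2)^2) * (b3*y3^2*(1+0.66*b3)^2) < 5"
proof -
  have "b1*b2*b3 \<le> ((b1+b2+b3)/3)^3" using assms by (intro amgm3) auto
  hence 1: "b1*b2*b3 \<le> 1/27" using assms by (simp add: power3_eq_cube)
  have "(1+0.66*b1)*(1+0.66*b2)*(1+0.66*b3) \<le> ((1+0.66*b1+(1+0.66*b2)+(1+0.66*b3))/3)^3"
    using assms by (intro amgm3) auto
  also have "(1+0.66*b1+(1+0.66*b2)+(1+0.66*b3))/3 = (3 + 0.66*(b1+b2+b3))/3" by simp
  also have "\<dots> = 1.22" using assms by simp
  finally have 2: "((1+0.66*b1)*(1+0.66*b2)*(1+0.66*b3))^2 \<le> (1.22^3)^2"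
    using assms by (intro power_mono) auto
  have "(b1*b2*b3) * (y1^2*y2^2*y3^2) * ((1+0.66*b1)*(1+0.66*b2)*(1+0.66*b3))^2 \<le> (1/27) * 32 * (1.22^3)^2"
    using 1 2 assms by (intro mult_mono) auto
  also have "\<dots> < 5" by (simp add: power3_eq_cube power2_eq_square)
  finally show ?thesis by (simp add: power_mult_distrib mult_ac)
qed

text \<open>If all denominators were 1, the squared sides would be 0 or 1 and Heron's expression
  would be 4, but for such values it is at most 3.\<close>

lemma denominators_prod_ge_2: fixes d1 d2 d3 a1 b1 a2 b2 a3 b3 :: int
  assumes d: "0 < d1" "0 < d2" "0 < d3"
    and sa: "d1*a1 + d2*a2 + d3*a3 = 0" and sb: "d1*b1 + d2*b2 + d3*b3 = 0"
    and cr: "\<bar>a1*b2 - b1*a2\<bar> = d3"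
    and fat: "d1^2*(a1^2+b1^2) < 2*(d1*d2*d3)" "d2^2*(a2^2+b2^2) < 2*(d1*d2*d3)" "d3^2*(a3^2+b3^2) < 2*(d1*d2*d3)"
  shows "2 \<le> d1*d2*d3"
proof (rule ccontr)
  assume "\<not> ?thesis"
  moreover have "0 < d1*d2*d3" using d by simp
  ultimately have D: "d1*d2*d3 = 1" by linarith
  hence "d1 = 1" "d2 = 1" "d3 = 1" using d by (auto simp: zmult_eq_1_iff)
  note o = this
  have a3: "a3 = - a1 - a2" "b3 = - b1 - b2" using sa sb o by auto
  define p q r where "p = a1^2+b1^2" "q = a2^2+b2^2" "r = a3^2+b3^2"
  have r: "p < 2" "q < 2" "r < 2" "0 \<le> p" "0 \<le> q" "0 \<le> r" using fat o by (auto simp: p_q_r_def)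
  have "\<bar>a1*b2 - b1*a2\<bar>^2 = 1" using cr o by simp
  hence "4*p*q - (r-p-q)^2 = 4" unfolding p_q_r_def a3 power2_abs by algebra
  moreover have "p \<in> {0,1}" "q \<in> {0,1}" "r \<in> {0,1}" using r by auto
  ultimately show False by (auto simp: power2_eq_square)
qed

lemma mult3_mono: fixes a b c x y z :: real
  assumes "a \<le> x" "b \<le> y" "c \<le> z" "0 \<le> a" "0 \<le> b" "0 \<le> c"
  shows "a*b*c \<le> x*y*z"
  using assms by (intro mult_mono) auto

lemma le_prod3: fixes x y z :: int assumes "0 < x" "0 < y" "0 < z"
  shows "x \<le> x*y*z" "y \<le> x*y*z" "z \<le> x*y*z"
proof -
  have "1 \<le> x*y" "1 \<le> x*z" "1 \<le> y*z" using assms by (simp_all add: int_one_le_iff_zero_less)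
  hence "x * 1 \<le> x * (y*z)" "y * 1 \<le> y * (x*z)" "z * 1 \<le> z*(x*y)"
    using assms by (auto intro!: mult_left_mono)
  thus "x \<le> x*y*z" "y \<le> x*y*z" "z \<le> x*y*z" by (simp_all add: mult_ac)
qed

text \<open>The weights \<open>d\<^sub>i * lin\<close> are barycentric coordinates, hence of product at most \<open>1/27\<close>. Heron's
  formula bounds the product of the \<open>d\<^sub>i\<^sup>2 * qf\<close> by \<open>32 (d\<^sub>1 d\<^sub>2 d\<^sub>3)\<^sup>3\<close>, so the product of the norms is
  below 5, while no norm equals 2, 3 or 4.\<close>

lemma all_norms_one: fixes d1 d2 d3 a1 b1 c1 a2 b2 c2 a3 b3 c3 :: int
  assumes d: "0 < d1" "0 < d2" "0 < d3"
    and sa: "d1*a1 + d2*a2 + d3*a3 = 0" and sb: "d1*b1 + d2*b2 + d3*b3 = 0"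
    and cr: "\<bar>a1*b2 - b1*a2\<bar> = d3"
    and t: "0 < lin a1 b1 c1" "0 < lin a2 b2 c2" "0 < lin a3 b3 c3"
    and st: "d1*lin a1 b1 c1 + d2*lin a2 b2 c2 + d3*lin a3 b3 c3 = 1"
    and n1: "nrm a1 b1 c1 = 1 \<or> nrm a1 b1 c1 \<ge> 5"
    and n2: "nrm a2 b2 c2 = 1 \<or> nrm a2 b2 c2 \<ge> 5"
    and n3: "nrm a3 b3 c3 = 1 \<or> nrm a3 b3 c3 \<ge> 5"
    and fat: "d1^2*(a1^2+b1^2) \<le> 1.50362*(d1*d2*d3)" "d2^2*(a2^2+b2^2) \<le> 1.50362*(d1*d2*d3)"
       "d3^2*(a3^2+b3^2) \<le> 1.50362*(d1*d2*d3)"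
  shows "nrm a1 b1 c1 = 1 \<and> nrm a2 b2 c2 = 1 \<and> nrm a3 b3 c3 = 1"
proof -
  define D :: int where "D = d1*d2*d3"
  have D0: "0 < D" using d by (simp add: D_def)
  have Dr: "real_of_int d1 * real_of_int d2 * real_of_int d3 = real_of_int D" by (simp add: D_def)
  have "real_of_int (d1^2*(a1^2+b1^2)) < real_of_int (2*D)"
    "real_of_int (d2^2*(a2^2+b2^2)) < real_of_int (2*D)"
    "real_of_int (d3^2*(a3^2+b3^2)) < real_of_int (2*D)"
  proof -
    have "1.50362 * real_of_int D < real_of_int (2*D)" using D0 by simp
    moreover have "real_of_int (d1^2*(a1^2+b1^2)) \<le> 1.50362 * real_of_int D"
      "real_of_int (d2^2*(a2^2+b2^2)) \<le> 1.50362 * real_of_int D"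
      "real_of_int (d3^2*(a3^2+b3^2)) \<le> 1.50362 * real_of_int D" using fat by (simp_all add: D_def)
    ultimately show "real_of_int (d1^2*(a1^2+b1^2)) < real_of_int (2*D)"
      "real_of_int (d2^2*(a2^2+b2^2)) < real_of_int (2*D)"
      "real_of_int (d3^2*(a3^2+b3^2)) < real_of_int (2*D)" by (meson order_le_less_trans)+
  qed
  hence D2: "2 \<le> D" unfolding D_def of_int_less_iff using denominators_prod_ge_2[OF d sa sb cr] by blast
  have q5: "(real_of_int e)^2 * qf a b \<le> 5 * real_of_int D"
    if "e^2*(a^2+b^2) \<le> 1.50362*real_of_int D" for e a b :: int
    using fat_qf that D0 by blast
  define q1 q2 q3 where "q1 = (real_of_int d1)^2 * qf a1 b1 / D"
    and "q2 = (real_of_int d2)^2 * qf a2 b2 / D" and "q3 = (real_of_int d3)^2 * qf a3 b3 / D"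
  have le5: "q1 \<le> 5" "q2 \<le> 5" "q3 \<le> 5"
    using q5[of d1 a1 b1] q5[of d2 a2 b2] q5[of d3 a3 b3] fat D0 Dr
    by (auto simp: q1_def q2_def q3_def divide_le_eq)
  have ge0: "0 \<le> q1" "0 \<le> q2" "0 \<le> q3" using D0 qf_nonneg by (auto simp: q1_def q2_def q3_def)
  have her: "4*q1*q2 - (q3-q1-q2)^2 = 23"
  proof -
    \<comment> \<open>The vectors \<open>(d*a, d*b)\<close> sum to zero, so they are the sides of a
      triangle, of determinant D up to sign.\<close>
    have e3: "d1*a1+d2*a2 = (-d3)*a3" "d1*b1+d2*b2 = (-d3)*b3" using sa sb by auto
    have "(d1*a1*(d2*b2) - d1*b1*(d2*a2)) = d1*d2*(a1*b2-b1*a2)" by algebra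
    also have "\<bar>\<dots>\<bar> = D" using cr d by (simp add: abs_mult D_def)
    finally have "\<bar>d1*a1*(d2*b2) - d1*b1*(d2*a2)\<bar> = D" .
    hence "(real_of_int (d1*a1*(d2*b2) - d1*b1*(d2*a2)))^2 = (real_of_int D)^2"
      by (metis of_int_power power2_abs)
    moreover have "qf (-d3*a3) (-d3*b3) = real_of_int D * q3" "qf (d1*a1) (d1*b1) = D * q1" "qf (d2*a2) (d2*b2) = D * q2"
      using D0 by (simp_all only: qf_scale q1_def q2_def q3_def) simp_all
    ultimately have "4 * (D*q1) * (D*q2) - (D*q3 - D*q1 - D*q2)^2 = 23 * (real_of_int D)^2"
      using qf_heron[of "d1*a1" "d1*b1" "d2*a2" "d2*b2"] unfolding e3 by simp
    hence "(real_of_int D)^2 * (4*q1*q2 - (q3-q1-q2)^2) = (real_of_int D)^2 * 23"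
      by (simp add: power2_eq_square algebra_simps)
    thus ?thesis using D0 by simp
  qed
  have pos: "0 < q1" "0 < q2" "0 < q3"
  proof -
    have "0 < 4*q1*q2" using her zero_le_power2[of "q3-q1-q2"] by linarith
    thus "0 < q1" "0 < q2" using ge0 by (auto simp: zero_less_mult_iff)
    have "4*q1*q3 - (q2-q1-q3)^2 = 23" using her by (simp add: power2_eq_square algebra_simps)
    hence "0 < 4*q1*q3" using zero_le_power2[of "q2-q1-q3"] by linarith
    thus "0 < q3" using ge0 by (auto simp: zero_less_mult_iff)
  qed
  have her': "4*q2*q3 - (q1-q2-q3)^2 = 23" using her by (simp add: power2_eq_square algebra_simps)
  note hp = heron_prod[OF le5 pos her']
  have sq: "1.0723 \<le> sqrt x" if "1.15 \<le> x" for x :: real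
    using that by (intro real_le_rsqrt) (simp add: power2_eq_square)
  have nt: "real_of_int e^3 * nrm a b c \<le> D * ((e * lin a b c) * (sqrt q)^2 * (1 + 0.66 * (e * lin a b c))^2)"
    if "0 < lin a b c" "0 < e" "q = (real_of_int e)^2 * qf a b / D" "1.15 \<le> q" for a b c e :: int and q
  proof (rule nrm_le_term)
    show "sqrt q = real_of_int e * sqrt (qf a b) / sqrt D"
      using that D0 by (simp add: real_sqrt_divide real_sqrt_mult)
  qed (use that D2 D0 sq in auto)
  define \<beta>1 \<beta>2 \<beta>3 where "\<beta>1 = d1*lin a1 b1 c1" and "\<beta>2 = d2*lin a2 b2 c2" and "\<beta>3 = d3*lin a3 b3 c3"
  note m = nt[OF t(1) d(1) q1_def hp(2)] nt[OF t(2) d(2) q2_def hp(3)] nt[OF t(3) d(3) q3_def hp(4)]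
  have bpos: "0 < \<beta>1" "0 < \<beta>2" "0 < \<beta>3" using t d by (auto simp: \<beta>1_def \<beta>2_def \<beta>3_def)
  have npos: "0 < nrm a1 b1 c1" "0 < nrm a2 b2 c2" "0 < nrm a3 b3 c3" using n1 n2 n3 by linarith+
  let ?N = "nrm a1 b1 c1 * nrm a2 b2 c2 * nrm a3 b3 c3"
  have "(real_of_int d1^3 * nrm a1 b1 c1) * (real_of_int d2^3 * nrm a2 b2 c2) * (real_of_int d3^3 * nrm a3 b3 c3)
    \<le> (D * (\<beta>1 * (sqrt q1)^2 * (1 + 0.66 * \<beta>1)^2)) * (D * (\<beta>2 * (sqrt q2)^2 * (1 + 0.66 * \<beta>2)^2)) *
      (D * (\<beta>3 * (sqrt q3)^2 * (1 + 0.66 * \<beta>3)^2))"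
    using m npos d D0 bpos unfolding \<beta>1_def[symmetric] \<beta>2_def[symmetric] \<beta>3_def[symmetric]
    by (intro mult3_mono) auto
  also have "\<dots> = real_of_int D^3 * ((\<beta>1 * (sqrt q1)^2 * (1 + 0.66 * \<beta>1)^2) * (\<beta>2 * (sqrt q2)^2 * (1 + 0.66 * \<beta>2)^2) *
      (\<beta>3 * (sqrt q3)^2 * (1 + 0.66 * \<beta>3)^2))" by (simp add: power3_eq_cube)
  also have "\<dots> < real_of_int D^3 * 5"
  proof (intro mult_strict_left_mono norm_prod_bound)
    show "(sqrt q1)^2 * (sqrt q2)^2 * (sqrt q3)^2 \<le> 32" using hp(1) pos by simp
  qed (use bpos st D0 in \<open>auto simp: \<beta>1_def \<beta>2_def \<beta>3_def\<close>)
  also have "(real_of_int d1^3 * nrm a1 b1 c1) * (real_of_int d2^3 * nrm a2 b2 c2) * (real_of_int d3^3 * nrm a3 b3 c3)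
    = real_of_int (D^3 * ?N)" by (simp add: D_def power3_eq_cube)
  finally have "real_of_int (D^3 * ?N) < real_of_int (D^3 * 5)" by simp
  hence "D^3 * ?N < D^3 * 5" by linarith
  hence N5: "?N < 5" using D0 by simp
  have "nrm a1 b1 c1 \<le> ?N" "nrm a2 b2 c2 \<le> ?N" "nrm a3 b3 c3 \<le> ?N"
    using npos le_prod3 by auto
  thus ?thesis using n1 n2 n3 N5 by linarith
qed

section \<open>Triples of units\<close>

definition ucross :: "nat \<Rightarrow> nat \<Rightarrow> int" where
  "ucross m n = ucoord (m+2) * ucoord n - ucoord m * ucoord (n+2)"

definition unorm2 :: "nat \<Rightarrow> int" where
  "unorm2 k = (ucoord (k+2))^2 + (ucoord k)^2"

text \<open>An executable test, with 1.50362 cleared of decimals. The multipliers come without their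
  common sign, hence the sign comparisons and absolute values.\<close>

fun fat3 :: "int \<times> int \<times> int \<Rightarrow> int \<times> int \<times> int \<Rightarrow> int \<times> int \<times> int \<Rightarrow> bool" where
  "fat3 (x1,y1,z1) (x2,y2,z2) (x3,y3,z3) = (let d1 = x2*y3-y2*x3; d2 = x3*y1-y3*x1; d3 = x1*y2-y1*x2 in
     if 0 < d1*d2 \<and> 0 < d1*d3 \<and> \<bar>d1*z1+d2*z2+d3*z3\<bar> = 1 then
       (let D = \<bar>d1*d2*d3\<bar> in 100000*(d1*d1*(x1*x1+y1*y1)) \<le> 150362*D \<and>
         100000*(d2*d2*(x2*x2+y2*y2)) \<le> 150362*D \<and> 100000*(d3*d3*(x3*x3+y3*y3)) \<le> 150362*D)
     else False)"

definition uvec :: "nat \<Rightarrow> int \<times> int \<times> int" where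
  "uvec k = (ucoord (k+2), ucoord k, ucoord (k+1))"

fun no_fat_pair where
  "no_fat_pair p q [] = True"
| "no_fat_pair p q (r # rs) = (if fat3 p q r then False else no_fat_pair p q rs)"

fun no_fat_head where
  "no_fat_head p [] = True"
| "no_fat_head p (q # rs) = (if no_fat_pair p q rs then no_fat_head p rs else False)"

text \<open>The counter limits only the position of the first member of a triple; the other two
  range over the rest of the list.\<close>

fun no_fat where
  "no_fat 0 vs = True"
| "no_fat (Suc n) [] = True"
| "no_fat (Suc n) (p # rs) = (if no_fat_head p rs then no_fat n rs else False)"

text \<open>Repeated multiplication by \<open>phi\<close>, as in \<open>lin_shift\<close>.\<close>

fun orbit :: "nat \<Rightarrow> int \<times> int \<times> int \<Rightarrow> (int \<times> int \<times> int) list" where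
  "orbit 0 v = []"
| "orbit (Suc n) (x,y,z) = (x,y,z) # orbit n (y-x,z,x)"

lemma no_fat_pairD: "no_fat_pair p q rs \<Longrightarrow> k < length rs \<Longrightarrow> \<not> fat3 p q (rs!k)"
  by (induction rs arbitrary: k) (auto simp: nth_Cons split: if_splits nat.splits)

lemma no_fat_headD: "no_fat_head p rs \<Longrightarrow> j < k \<Longrightarrow> k < length rs \<Longrightarrow> \<not> fat3 p (rs!j) (rs!k)"
proof (induction rs arbitrary: j k)
  case (Cons q rs)
  then obtain k' where k: "k = Suc k'" by (cases k) auto
  show ?case using Cons no_fat_pairD[of p q rs k'] k
    by (cases j) (auto split: if_splits)
qed simp

lemma no_fatD: "no_fat n vs \<Longrightarrow> i < n \<Longrightarrow> i < j \<Longrightarrow> j < k \<Longrightarrow> k < length vs \<Longrightarrow> \<not> fat3 (vs!i) (vs!j) (vs!k)"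
proof (induction n vs arbitrary: i j k rule: no_fat.induct)
  case (3 n p rs)
  then obtain j' k' where jk: "j = Suc j'" "k = Suc k'" by (cases j; cases k) auto
  show ?case using 3 no_fat_headD[of p rs j' k'] jk
    by (cases i) (auto split: if_splits)
qed auto

lemma orbit_uvec: "orbit n (uvec k) = map uvec [k..<k+n]"
proof (induction n arbitrary: k)
  case (Suc n)
  have "orbit (Suc n) (uvec k) = uvec k # orbit n (uvec (Suc k))" by (simp add: uvec_def)
  moreover have "[k..<k + Suc n] = k # [Suc k..<Suc k + n]" by (subst upt_conv_Cons) auto
  ultimately show ?case using Suc[of "Suc k"] by simp
qed simp

text \<open>The difference of the exponents is at most 16 by \<open>exponent_spread\<close> below, which makes the case
  of smallest exponent at most 11 a finite one.\<close>

lemma no_fat_check: "no_fat 11 (orbit 27 (0,1,0))"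
  by code_simp

lemma no_fat_small: assumes "1 \<le> a" "a \<le> 11" "a < b" "b < c" "c \<le> 27"
  shows "\<not> fat3 (uvec a) (uvec b) (uvec c)"
proof -
  have "(0,1,0) = uvec 1" by (simp add: uvec_def numeral_3_eq_3)
  hence "orbit 27 (0,1,0) = map uvec [1..<28]" using orbit_uvec[of 27 1] by simp
  hence nf: "no_fat 11 (map uvec [1..<28])" using no_fat_check by simp
  have "uvec a = map uvec [1..<28] ! (a-1)" "uvec b = map uvec [1..<28] ! (b-1)" "uvec c = map uvec [1..<28] ! (c-1)"
    using assms by (auto simp: nth_map)
  thus ?thesis using no_fatD[OF nf, of "a-1" "b-1" "c-1"] assms by simp
qed

text \<open>Padovan numbers: up to sign, the multipliers \<open>d\<^sub>i\<close> of a triple of powers of \<open>\<phi>\<close> are sums of them.\<close>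

fun pad :: "nat \<Rightarrow> int" where
  "pad 0 = 0"
| "pad (Suc 0) = 1"
| "pad (Suc (Suc 0)) = 0"
| "pad (Suc (Suc (Suc n))) = pad n + pad (Suc n)"

lemma ucross_self: "ucross k k = 0" unfolding ucross_def by simp
lemma ucross_swap: "ucross m n = - ucross n m" unfolding ucross_def by simp
lemma ucross_rec: "ucross m (n+3) = ucross m n - ucross m (n+2)"
  unfolding ucross_def by (simp add: numeral_eq_Suc algebra_simps)

lemma ucross_2_aux: "ucross k (k+2) = - ucross (k+2) (k+3)" using ucross_rec[of "k+2" k] ucross_self[of "k+2"] ucross_swap[of "k+2" k] by simp

text \<open>Determinants of neighbouring powers satisfy the Padovan recurrence; the values at
  distances 2 to 6 then follow from \<open>ucross_rec\<close>.\<close>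

lemma ucross_1: "ucross k (k+1) = - pad k"
proof (induction k rule: pad.induct)
  case (4 n)
  have "ucross (n+3) (n+4) = - ucross (n+1) (n+3)" using ucross_2_aux[of "n+1"] by (simp add: numeral_eq_Suc)
  moreover have "ucross (n+1) (n+3) = ucross (n+1) n - ucross (n+1) (n+2)" by (rule ucross_rec)
  moreover have "ucross (n+1) n = - ucross n (n+1)" by (rule ucross_swap)
  ultimately show ?case using 4 by (simp add: numeral_eq_Suc)
qed (simp_all add: ucross_def numeral_eq_Suc)

lemma ucross_2: "ucross k (k+2) = pad (k+2)" using ucross_2_aux[of k] ucross_1[of "k+2"] by (simp add: numeral_3_eq_3)
lemma ucross_3: "ucross k (k+3) = - pad (k+2)" using ucross_rec[of k k] ucross_2[of k] ucross_self[of k] by simp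
lemma ucross_4: "ucross k (k+4) = pad (k+2) - pad k" using ucross_rec[of k "k+1"] ucross_3[of k] ucross_1[of k] by (simp add: numeral_eq_Suc)
lemma ucross_5: "ucross k (k+5) = pad k" using ucross_rec[of k "k+2"] ucross_4[of k] ucross_2[of k] by (simp add: numeral_eq_Suc)
lemma ucross_6: "ucross k (k+6) = - pad (k+2) - pad k" using ucross_rec[of k "k+3"] ucross_5[of k] ucross_3[of k] by (simp add: numeral_eq_Suc)

lemma pad_3: "pad (n+3) = pad n + pad (n+1)" by (simp add: numeral_3_eq_3)

text \<open>Consecutive ratios tend to 1/phi, about 1.3247, with square about 1.7549. The bound 1.3
  fails at 11, where 13*7 > 10*9; from 12 on both bounds propagate through the recurrence.\<close>

lemma pad_ratio: "12 \<le> k \<Longrightarrow> 0 < pad k \<and> 17 * pad k \<le> 10 * pad (k+2) \<and> 13 * pad k \<le> 10 * pad (k+1)"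
proof (induction k rule: less_induct)
  case (less k)
  show ?case
  proof (cases "k \<le> 14")
    case True
    hence "k = 12 \<or> k = 13 \<or> k = 14" using less by auto
    thus ?thesis by (auto simp: eval_nat_numeral)
  next
    case False
    hence "k = (k-3) + 3 \<and> 12 \<le> k - 3" by linarith
    then obtain n where n: "k = n + 3" "12 \<le> n" by blast
    have 0: "0 < pad n \<and> 17 * pad n \<le> 10 * pad (n+2) \<and> 13 * pad n \<le> 10 * pad (n+1)" using less n by auto
    have 1: "0 < pad (n+1) \<and> 17 * pad (n+1) \<le> 10 * pad (n+3) \<and> 13 * pad (n+1) \<le> 10 * pad (n+2)"
      using less(1)[of "n+1"] n by (simp add: numeral_eq_Suc)
    show ?thesis using 0 1 n(1) by (simp add: numeral_eq_Suc)
  qed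
qed

text \<open>The barycentric identity for the exponents k, k+1, k+2; passing to k+1 uses
  \<open>phi^k = phi^(k+2) + phi^(k+3)\<close>.\<close>

lemma pad_phi: "pad (k+1) * phi^k + pad (k+2) * phi^(k+1) + pad k * phi^(k+2) = 1"
proof (induction k)
  case 0
  show ?case by (simp add: numeral_eq_Suc)
next
  case (Suc k)
  have "phi^(k+2) + phi^(k+3) = phi^k * (phi^3 + phi^2)" by (simp add: numeral_eq_Suc algebra_simps)
  hence e: "phi^(k+2) + phi^(k+3) = phi^k" unfolding phi_eq by simp
  have "pad (k+2) * phi^(k+1) + (pad k + pad (k+1)) * phi^(k+2) + pad (k+1) * phi^(k+3)
    = pad (k+1) * (phi^(k+2) + phi^(k+3)) + pad (k+2) * phi^(k+1) + pad k * phi^(k+2)"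
    by (simp add: algebra_simps)
  also have "\<dots> = 1" unfolding e using Suc by simp
  finally show ?case by (simp add: numeral_eq_Suc)
qed

text \<open>The excess grows with X, so \<open>eX\<close> reduces to X = 2.675 or, if Y is larger,
  to X = Y. At X = 2.675 the cubic in Y has its minimum near 2.125, and \<open>eY\<close> supplies
  the tangent there.\<close>

lemma cubic_ineq: fixes X Y :: real assumes X: "2.675 \<le> X" and Y: "0 < Y" "Y \<le> X"
  shows "5.066 * (X * Y) < X^3 + Y^3 + 1"
proof -
  have eX: "(X - u) * (X*X + u*X + u*u - k*Y) = X^3 - u^3 - k*(X*Y) + k*u*Y" for u k :: real by algebra
  have eY: "(Y - e)^2 * (Y + 2*e) = Y^3 - 3*e^2*Y + 2*e^3" for e :: real by algebra
  show ?thesis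
  proof (cases "Y \<le> 2.675")
    case True
    have s: "2.675 * 2.675 \<le> X * X" "2.675 * 2.675 \<le> 2.675 * X" using X by (intro mult_mono; simp)+
    have "0 \<le> (X - 2.675) * (X*X + 2.675*X + 2.675*2.675 - 5.066*Y)"
      using X True s by (intro mult_nonneg_nonneg) auto
    moreover have "0 \<le> (Y - 2.125)^2 * (Y + 2*2.125)" using Y by simp
    ultimately show ?thesis using True unfolding eX eY by (simp add: power2_eq_square power3_eq_cube)
  next
    case False
    have "Y * (5.066 * 1) \<le> Y * (3 * Y)" using Y False by (intro mult_left_mono) auto
    moreover have "Y * Y \<le> X * X" "Y * Y \<le> X * Y" using Y by (auto intro: mult_mono)
    ultimately have "0 \<le> X*X + Y*X + Y*Y - 5.066*Y" unfolding mult.commute[of Y X] by simp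
    hence "0 \<le> (X - Y) * (X*X + Y*X + Y*Y - 5.066*Y)"
      using Y by (intro mult_nonneg_nonneg) auto
    moreover have "0 \<le> Y^2 * (2*Y - 5.066)" using False by simp
    ultimately show ?thesis unfolding eX by (simp add: power2_eq_square power3_eq_cube algebra_simps)
  qed
qed

section \<open>Bounds for the differences of the exponents\<close>

definition rphi :: real where "rphi = sqrt phi"
lemma rphi_square: "rphi^2 = phi" and rphi_pos: "0 < rphi" and rphi_less_1: "rphi < 1"
  using phi_lb phi_ub by (auto simp: rphi_def)
lemma rphi_power2: "(rphi^k)^2 = phi^k" by (metis power_mult mult.commute rphi_square)

lemma phi_power_bounds: "phi^9 \<le> 0.0796" "phi^3 \<le> 0.4302"
proof -
  have e: "phi^3 = 1 - phi^2" using phi_eq by simp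
  hence 1: "phi^3 \<le> 0.430161" using phi_sq_bounds by simp
  thus "phi^3 \<le> 0.4302" by simp
  have "phi^9 = (phi^3)^3" by (simp flip: power_mult)
  also have "\<dots> \<le> 0.430161^3" using 1 phi_lb by (intro power_mono) auto
  finally show "phi^9 \<le> 0.0796" by (simp add: power3_eq_cube)
qed

text \<open>On \<open>phi^k\<close> the norm 1 makes \<open>psi\<close> the inverse of
  \<open>phi^k\<close>, with root \<open>1 / rphi^k\<close>; then \<open>sqrt_qf_ge\<close>
  applies.\<close>

lemma sqrt_qf_unit: "(1 - (rphi^k)^3) / rphi^k \<le> sqrt (qf (ucoord (k+2)) (ucoord k))"
proof -
  let ?l = "lin (ucoord (k+2)) (ucoord k) (ucoord (k+1))" and ?p = "psi (ucoord (k+2)) (ucoord k) (ucoord (k+1))"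
  have l: "?l = (rphi^k)^2" unfolding lin_unit rphi_power2 ..
  have p: "0 < rphi^k" using rphi_pos by simp
  have "?l * ?p = 1" using nrm_eq[of "ucoord (k+2)" "ucoord k" "ucoord (k+1)"] nrm_unit[of k] by simp
  hence "?p = (1 / rphi^k)^2" unfolding l using p rphi_pos by (simp add: eq_divide_eq mult.commute power_divide)
  hence "sqrt ?p = 1 / rphi^k" using p by simp
  moreover have "sqrt ?p - ?l \<le> sqrt (qf (ucoord (k+2)) (ucoord k))" using l by (intro sqrt_qf_ge) simp
  moreover have "1 / u - u^2 = (1 - u^3) / u" if "0 < u" for u :: real
    using that by (simp add: field_simps power2_eq_square power3_eq_cube)
  note this[OF p]
  ultimately show ?thesis unfolding l by simp
qed

text \<open>Multiplying the conditions for two sides cancels their own multipliers and leaves the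
  third.\<close>

lemma pair_bound: fixes x y z Q R :: real
  assumes "0 < x" "0 < y" "0 < z" "0 \<le> Q" "0 \<le> R" "x^2 * Q \<le> 5 * (x*y*z)" "y^2 * R \<le> 5 * (x*y*z)"
  shows "sqrt Q * sqrt R \<le> 5 * z"
proof -
  have "(x^2 * Q) * (y^2 * R) \<le> (5 * (x*y*z)) * (5 * (x*y*z))"
    using assms by (intro mult_mono[OF assms(6,7)]) auto
  hence "(x*y)^2 * (Q * R) \<le> (x*y)^2 * (5*z)^2" by (simp add: power2_eq_square mult_ac)
  hence "Q * R \<le> (5*z)^2" using assms by simp
  hence "sqrt (Q * R) \<le> 5 * z" using assms by (intro real_le_lsqrt) auto
  thus ?thesis by (simp add: real_sqrt_mult)
qed

lemma pair_bound_unit: fixes x y z :: real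
  assumes "0 < x" "0 < y" "0 < z" "x^2 * qf (ucoord (a+2)) (ucoord a) \<le> 5 * (x*y*z)"
    "y^2 * qf (ucoord (b+2)) (ucoord b) \<le> 5 * (x*y*z)"
  shows "(1 - (rphi^a)^3) * (1 - (rphi^b)^3) \<le> 5 * z * (rphi^a * rphi^b)"
proof -
  have p: "0 < rphi^a" "0 < rphi^b" using rphi_pos by auto
  have le1: "(rphi^k)^3 \<le> 1" for k using rphi_pos rphi_less_1 by (simp add: power_le_one)
  have "((1 - (rphi^a)^3) / rphi^a) * ((1 - (rphi^b)^3) / rphi^b) \<le> sqrt (qf (ucoord (a+2)) (ucoord a)) * sqrt (qf (ucoord (b+2)) (ucoord b))"
    using p le1 qf_nonneg by (intro mult_mono sqrt_qf_unit) auto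
  also have "\<dots> \<le> 5 * z" using assms qf_nonneg by (intro pair_bound[of x y z]) auto
  finally show ?thesis using p by (simp add: field_simps)
qed

text \<open>The pair b, c bounds \<open>d1\<close> from below by a multiple of 1/rphi^(b+c), while
  \<open>st\<close> gives \<open>d1 * phi^a\<close> at most 1, so b + c - 2a is bounded. A gap of 17
  would make it at least 18, and rphi^18 = phi^9.\<close>

lemma exponent_spread: fixes d1 d2 d3 :: real
  assumes d: "0 < d1" "0 < d2" "0 < d3" and ord: "1 \<le> a" "a < b" "b < c"
   and st: "d1 * phi^a + d2 * phi^b + d3 * phi^c = 1"
   and f2: "d2^2 * qf (ucoord (b+2)) (ucoord b) \<le> 5 * (d1*d2*d3)"
   and f3: "d3^2 * qf (ucoord (c+2)) (ucoord c) \<le> 5 * (d1*d2*d3)"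
  shows "c \<le> a + 16"
proof (rule ccontr)
  assume "\<not> ?thesis" hence c: "a + 17 \<le> c" by simp
  have dec: "rphi^n \<le> rphi^m" if "m \<le> n" for m n using rphi_pos rphi_less_1 that by (simp add: power_decreasing)
  have p: "0 < rphi^a" "0 < rphi^b" "0 < rphi^c" using rphi_pos by auto
  have "0 \<le> d2 * phi^b" "0 \<le> d3 * phi^c" using d phi_lb by simp_all
  hence d1: "d1 * (rphi^a)^2 \<le> 1" unfolding rphi_power2 using st by linarith
  have "rphi^b * rphi^c \<le> rphi^(a+1) * rphi^(a+17)" using ord c p by (intro mult_mono[OF dec dec]) (auto simp: less_imp_le rphi_pos)
  also have "\<dots> = (rphi^a)^2 * (rphi^2)^9" by (simp add: power_add power2_eq_square eval_nat_numeral mult_ac)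
  also have "\<dots> = (rphi^a)^2 * phi^9" by (simp only: rphi_square)
  also have "\<dots> \<le> (rphi^a)^2 * 0.0796" using phi_power_bounds by (intro mult_left_mono) auto
  finally have bc: "rphi^b * rphi^c \<le> (rphi^a)^2 * 0.0796" .
  have "(1 - (rphi^b)^3) * (1 - (rphi^c)^3) \<le> 5 * d1 * (rphi^b * rphi^c)"
    using d f2 f3 by (intro pair_bound_unit[of d2 d3]) (auto simp: mult_ac)
  also have "\<dots> \<le> 5 * d1 * ((rphi^a)^2 * 0.0796)" using d bc by (intro mult_left_mono) auto
  also have "\<dots> = 5 * 0.0796 * (d1 * (rphi^a)^2)" by simp
  also have "\<dots> \<le> 5 * 0.0796 * 1" using d1 by (intro mult_left_mono) auto
  finally have ub: "(1 - (rphi^b)^3) * (1 - (rphi^c)^3) \<le> 0.398" by simp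
  \<comment> \<open>As b \<ge> 2 and c \<ge> 3, the two factors are at least 1 - phi^3 and 1 -
    rphi^9, with product above 0.398.\<close>
  have "rphi^b \<le> rphi^2" using ord by (intro dec) linarith
  hence b3: "(rphi^b)^3 \<le> (rphi^2)^3" by (rule power_mono) (use p in simp)
  have "rphi^c \<le> rphi^3" using ord by (intro dec) linarith
  hence c3: "(rphi^c)^3 \<le> (rphi^3)^3" by (rule power_mono) (use p in simp)
  have "((rphi^3)^3)^2 = (rphi^2)^9" by (simp flip: power_mult)
  hence "((rphi^3)^3)^2 \<le> 0.2824^2" using phi_power_bounds(1) unfolding rphi_square by (simp add: power2_eq_square)
  hence "(rphi^3)^3 \<le> 0.2824" by (rule power2_le_imp_le) simp
  hence cb: "0.7176 \<le> 1 - (rphi^c)^3" using c3 by simp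
  have bb: "0.5698 \<le> 1 - (rphi^b)^3" using b3 phi_power_bounds(2) unfolding rphi_square by simp
  have "0.5698 * 0.7176 \<le> (1 - (rphi^b)^3) * (1 - (rphi^c)^3)"
    by (rule mult_mono[OF bb cb]) (use bb in auto)
  thus False using ub by simp
qed

text \<open>Multiplying the fatness conditions in pairs bounds each \<open>d\<^sub>i\<close> from below; inserted into
  \<open>st\<close> this gives \<open>p\<^sup>3 + q\<^sup>3 + r\<^sup>3 \<le> 5.066 p q r\<close> for the square roots of the three powers.\<close>

lemma exponent_spread_large: fixes d1 d2 d3 :: real
  assumes d: "0 < d1" "0 < d2" "0 < d3" and ord: "12 \<le> a" "a < b" "b < c"
   and st: "d1 * phi^a + d2 * phi^b + d3 * phi^c = 1"
   and f1: "d1^2 * qf (ucoord (a+2)) (ucoord a) \<le> 5 * (d1*d2*d3)"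
   and f2: "d2^2 * qf (ucoord (b+2)) (ucoord b) \<le> 5 * (d1*d2*d3)"
   and f3: "d3^2 * qf (ucoord (c+2)) (ucoord c) \<le> 5 * (d1*d2*d3)"
  shows "c \<le> a + 6"
proof (rule ccontr)
  assume "\<not> ?thesis" hence c: "a + 7 \<le> c" by simp
  define p q r where "p = rphi^a" and "q = rphi^b" and "r = rphi^c"
  have pos: "0 < p" "0 < q" "0 < r" using rphi_pos by (auto simp: p_def q_def r_def)
  have dec: "rphi^n \<le> rphi^m" if "m \<le> n" for m n using rphi_pos rphi_less_1 that by (simp add: power_decreasing)
  have small: "(rphi^k)^3 \<le> 0.0064" if "12 \<le> k" for k
  proof -
    have "(rphi^k)^3 \<le> (rphi^12)^3" using dec[OF that] rphi_pos by (intro power_mono) auto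
    also have "\<dots> = (phi^9)^2" by (simp add: rphi_square[symmetric] flip: power_mult)
    also have "\<dots> \<le> 0.0796^2" using phi_power_bounds phi_lb by (intro power_mono) auto
    finally show ?thesis by (simp add: power2_eq_square)
  qed
  \<comment> \<open>The constant is 5/0.987 rounded up, and 0.987 lies below 0.9936^2.\<close>
  have g: "1 \<le> 5.066 * z * (rphi^m * rphi^n)"
    if "(1 - (rphi^m)^3) * (1 - (rphi^n)^3) \<le> 5 * z * (rphi^m * rphi^n)" "12 \<le> m" "12 \<le> n" "0 < z" for z m n
  proof -
    have "0.9936 * 0.9936 \<le> (1 - (rphi^m)^3) * (1 - (rphi^n)^3)"
      using small[OF that(2)] small[OF that(3)] by (intro mult_mono) auto
    hence "0.987 \<le> 5 * (z * (rphi^m * rphi^n))" using that(1) by simp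
    thus ?thesis by simp
  qed
  have g3: "1 \<le> 5.066 * d3 * (p * q)" unfolding p_def q_def
    using d f1 f2 ord by (intro g pair_bound_unit[of d1 d2]) auto
  have g2: "1 \<le> 5.066 * d2 * (p * r)" unfolding p_def r_def
    using d f1 f3 ord by (intro g pair_bound_unit[of d1 d3]) (auto simp: mult_ac)
  have g1: "1 \<le> 5.066 * d1 * (q * r)" unfolding q_def r_def
    using d f2 f3 ord by (intro g pair_bound_unit[of d2 d3]) (auto simp: mult_ac)
  have "p^3 * 1 \<le> p^3 * (5.066 * d1 * (q * r))" "q^3 * 1 \<le> q^3 * (5.066 * d2 * (p * r))"
    "r^3 * 1 \<le> r^3 * (5.066 * d3 * (p * q))"
    using g1 g2 g3 pos by (auto intro!: mult_left_mono)
  hence "p^3 + q^3 + r^3 \<le> 5.066 * (p*q*r) * (d1 * p^2 + d2 * q^2 + d3 * r^2)"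
    by (simp add: power2_eq_square power3_eq_cube algebra_simps)
  also have "d1 * p^2 + d2 * q^2 + d3 * r^2 = 1" unfolding p_def q_def r_def rphi_power2 by (rule st)
  finally have sum: "p^3 + q^3 + r^3 \<le> 5.066 * (p*q*r)" by simp
  \<comment> \<open>The constant is phi^(-7/2) rounded down, from the gap of 7.\<close>
  have pr: "2.675 \<le> p / r"
  proof -
    have "r \<le> rphi^(a+7)" unfolding r_def using dec c by blast
    hence r: "r \<le> p * rphi^7" by (simp add: p_def power_add)
    have "phi^9 = phi^7 * phi^2" by (simp flip: power_add)
    moreover have "phi^2 \<noteq> 0" using phi_lb by simp
    ultimately have "(rphi^7)^2 = phi^9 / phi^2" unfolding rphi_power2 by (metis nonzero_mult_div_cancel_right)
    also have "\<dots> \<le> 0.0796 / 0.569839" using phi_power_bounds phi_sq_bounds by (intro frac_le) auto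
    also have "\<dots> \<le> (1/2.675)^2" by (simp add: power2_eq_square)
    finally have "rphi^7 \<le> 1/2.675" by (rule power2_le_imp_le) simp
    hence "p * rphi^7 \<le> p * (1/2.675)" using pos by (intro mult_left_mono) auto
    hence "r * 2.675 \<le> p" using r by simp
    thus ?thesis using pos by (simp add: field_simps)
  qed
  have "q \<le> p" unfolding p_def q_def using ord by (intro dec) auto
  hence "5.066 * ((p/r) * (q/r)) < (p/r)^3 + (q/r)^3 + 1" using pr pos
    by (intro cubic_ineq) (auto simp: divide_right_mono)
  hence "(5.066 * ((p/r) * (q/r))) * r^3 < ((p/r)^3 + (q/r)^3 + 1) * r^3"
    using pos by (intro mult_strict_right_mono) auto
  also have "\<dots> = p^3 + q^3 + r^3" using pos by (simp add: power_divide algebra_simps)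
  also have "(5.066 * ((p/r) * (q/r))) * r^3 = 5.066 * (p*q*r)" using pos by (simp add: power3_eq_cube)
  finally show False using sum by simp
qed

text \<open>By \<open>sqrt_qf_unit\<close>, \<open>qf\<close> is at least 0.987/phi^k, and
  \<open>pad_phi\<close> with the growth rates makes 1/phi^k at least 3.153 times
  \<open>pad k\<close>; 3.11 < 0.987 * 3.153.\<close>

lemma qf_pad: assumes "12 \<le> k" shows "3.11 * pad k \<le> qf (ucoord (k+2)) (ucoord k)"
proof -
  have p: "0 < pad k" "17 * pad k \<le> 10 * pad (k+2)" "13 * pad k \<le> 10 * pad (k+1)"
    using pad_ratio[OF assms] by auto
  define y where "y = phi^k"
  have y0: "0 < y" using phi_lb by (simp add: y_def)
  have r: "1.3 * real_of_int (pad k) \<le> pad (k+1)" "1.7 * real_of_int (pad k) \<le> pad (k+2)"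
    using p(2,3) by (simp_all flip: of_int_le_iff[where 'a=real])
  have "y * (1.3 * pad k + 1.7 * pad k * phi + pad k * phi^2) \<le> y * (pad (k+1) + pad (k+2) * phi + pad k * phi^2)"
    using y0 r phi_lb by (intro mult_left_mono add_mono mult_right_mono) auto
  also have "\<dots> = 1" using pad_phi[of k] by (simp add: y_def algebra_simps power2_eq_square)
  finally have "(y * pad k) * (1.3 + 1.7 * phi + phi^2) \<le> 1" by (simp add: algebra_simps)
  moreover have "(y * pad k) * 3.153 \<le> (y * pad k) * (1.3 + 1.7 * phi + phi^2)"
    using phi_lb phi_sq_bounds y0 p by (intro mult_left_mono) auto
  ultimately have yp: "y * pad k * 3.153 \<le> 1" by linarith
  have "(rphi^k)^3 \<le> (rphi^12)^3" using rphi_pos rphi_less_1 assms by (intro power_mono power_decreasing) auto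
  also have "\<dots> = (phi^9)^2" by (simp add: rphi_square[symmetric] flip: power_mult)
  also have "\<dots> \<le> 0.0796^2" using phi_power_bounds phi_lb by (intro power_mono) auto
  finally have s: "(rphi^k)^3 \<le> 0.0064" by (simp add: power2_eq_square)
  have "0.9936 / rphi^k \<le> (1 - (rphi^k)^3) / rphi^k" using s rphi_pos by (intro divide_right_mono) auto
  also have "\<dots> \<le> sqrt (qf (ucoord (k+2)) (ucoord k))" by (rule sqrt_qf_unit)
  finally have "(0.9936 / rphi^k)^2 \<le> (sqrt (qf (ucoord (k+2)) (ucoord k)))^2"
    using rphi_pos by (intro power_mono) auto
  hence "0.987 / y \<le> qf (ucoord (k+2)) (ucoord k)"
    using qf_nonneg y0 unfolding power_divide rphi_power2 y_def[symmetric]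
    by (simp add: power2_eq_square field_simps)
  moreover have "3.11 * pad k \<le> 0.987 / y" using yp y0 by (simp add: field_simps)
  ultimately show ?thesis by linarith
qed

text \<open>Through \<open>qf_pad\<close>, fatness becomes an inequality between integers; 161/100
  rounds up 5/3.11.\<close>

lemma fat_pad: fixes d1 d2 d3 :: int
  assumes "12 \<le> k" "0 < d1" "0 < d2" "0 < d3"
   "(real_of_int d1)^2 * qf (ucoord (k+2)) (ucoord k) \<le> 5 * (d1*d2*d3)"
  shows "100 * (d1 * pad k) \<le> 161 * (d2 * d3)"
proof -
  have "real_of_int d1 * (d1 * (3.11 * pad k)) = (real_of_int d1)^2 * (3.11 * pad k)" by (simp add: power2_eq_square)
  also have "\<dots> \<le> (real_of_int d1)^2 * qf (ucoord (k+2)) (ucoord k)"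
    using qf_pad[OF assms(1)] by (intro mult_left_mono) auto
  also have "\<dots> \<le> real_of_int d1 * (5 * (d2 * d3))" using assms(5) by simp
  finally have "real_of_int d1 * (3.11 * pad k) \<le> real_of_int (5 * (d2 * d3))" using assms(2) by simp
  hence "311 * real_of_int (d1 * pad k) \<le> 500 * real_of_int (d2 * d3)" by simp
  moreover have "0 < real_of_int (d2 * d3)" using mult_pos_pos[OF assms(3,4)] by linarith
  ultimately have "real_of_int (100 * (d1 * pad k)) \<le> real_of_int (161 * (d2 * d3))"
    unfolding of_int_mult[of 100] of_int_mult[of 161] by simp
  thus ?thesis by linarith
qed

lemma exponent_pairs: fixes i j :: nat assumes "0 < i" "i < j" "j \<le> 6"
  shows "i = 1 \<and> j = 2 \<or> i = 1 \<and> j = 3 \<or> i = 1 \<and> j = 4 \<or> i = 1 \<and> j = 5 \<or> i = 1 \<and> j = 6 \<or> i = 2 \<and> j = 3 \<or> i = 2 \<and> j = 4 \<or> i = 2 \<and> j = 5 \<or> i = 2 \<and> j = 6 \<or> i = 3 \<and> j = 4 \<or> i = 3 \<and> j = 5 \<or> i = 3 \<and> j = 6 \<or> i = 4 \<and> j = 5 \<or> i = 4 \<and> j = 6 \<or> i = 5 \<and> j = 6"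
  using assms by presburger

text \<open>Ten of the fifteen exponent patterns make the \<open>d\<^sub>i\<close> of different signs, and in the other five
  the triangle is too thin by the growth rate of the Padovan numbers.\<close>

lemma no_fat_pad_pattern: fixes s d1 d2 d3 :: int
  assumes a: "12 \<le> a" and ij: "0 < i" "i < j" "j \<le> 6" and s: "s = 1 \<or> s = -1"
   and d: "d1 = s * ucross (a+i) (a+j)" "d2 = s * ucross (a+j) a" "d3 = s * ucross a (a+i)" "0 < d1" "0 < d2" "0 < d3"
   and F1: "100 * (d1 * pad a) \<le> 161 * (d2 * d3)"
   and F2: "100 * (d2 * pad (a+i)) \<le> 161 * (d1 * d3)"
   and F3: "100 * (d3 * pad (a+j)) \<le> 161 * (d1 * d2)"
  shows False
proof -
  define x y z where "x = pad a" and "y = pad (a+1)" and "z = pad (a+2)"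
  have p3: "pad (a+3) = x + y" using pad_3[of a] by (simp add: x_def y_def)
  have p4: "pad (a+4) = y + z" using pad_3[of "a+1"] by (simp add: y_def z_def add_ac numeral_eq_Suc)
  have p5: "pad (a+5) = x + y + z" using pad_3[of "a+2"] p3 by (simp add: z_def numeral_eq_Suc)
  have p6: "pad (a+6) = x + 2*y + z" using pad_3[of "a+3"] p3 p4 by (simp add: numeral_eq_Suc)
  have x0: "0 < x" "17*x \<le> 10*z" "13*x \<le> 10*y"
    using pad_ratio[of a] a by (auto simp: x_def y_def z_def)
  have y0: "0 < y" "7*y \<le> 10*x" "13*y \<le> 10*z"
    using pad_ratio[of "a+1"] a p3 by (auto simp: y_def z_def numeral_eq_Suc)
  have z0: "0 < z" "13*z \<le> 10*(x+y)"
    using pad_ratio[of "a+2"] a p3 by (auto simp: z_def numeral_eq_Suc)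
  note c = ucross_1 ucross_2 ucross_3 ucross_4 ucross_5 ucross_6
  have c01: "ucross a (a+1) = -x" "ucross a (a+2) = z" "ucross a (a+3) = -z" "ucross a (a+4) = z-x" "ucross a (a+5) = x" "ucross a (a+6) = -z-x"
    by (simp_all only: c x_def z_def)
  have c1: "ucross (a+1) (a+2) = -y" "ucross (a+1) (a+3) = x+y" "ucross (a+1) (a+4) = -x-y" "ucross (a+1) (a+5) = x" "ucross (a+1) (a+6) = y"
    using c[of "a+1"] p3 by (simp_all add: y_def numeral_eq_Suc)
  have c2: "ucross (a+2) (a+3) = -z" "ucross (a+2) (a+4) = y+z" "ucross (a+2) (a+5) = -y-z" "ucross (a+2) (a+6) = y"
    using c[of "a+2"] p4 by (simp_all add: z_def numeral_eq_Suc)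
  have c3: "ucross (a+3) (a+4) = -x-y" "ucross (a+3) (a+5) = x+y+z" "ucross (a+3) (a+6) = -x-y-z"
    using c[of "a+3"] p3 p5 by (simp_all add: numeral_eq_Suc)
  have c4: "ucross (a+4) (a+5) = -y-z" "ucross (a+4) (a+6) = x+2*y+z"
    using c[of "a+4"] p4 p6 by (simp_all add: numeral_eq_Suc)
  have c5: "ucross (a+5) (a+6) = -x-y-z" using c(1)[of "a+5"] p5 by (simp add: numeral_eq_Suc)
  have sw: "ucross (a+n) a = - ucross a (a+n)" for n by (rule ucross_swap)
  note cs = c01 c1 c2 c3 c4 c5 sw
  \<comment> \<open>The growth rates give z \<le> (10/13)(1 + 10/7) x < 1.9 x.\<close>
  have zx: "10 * (z - x) \<le> 9 * x"
  proof -
    have "91*z \<le> 170*x" using y0(2) z0(2) by simp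
    thus ?thesis using x0(1) by simp
  qed
  \<comment> \<open>First the patterns with multipliers of different signs; the digits in the names
    are the differences \<open>i\<close> and \<open>j\<close>.\<close>
  have F13: False if "i = 1" "j = 3"
  proof -
    have "d1 = s * (x+y)" "d2 = s * (- (-z))" "d3 = s * (-x)"
      unfolding d(1-3) that cs by (rule refl)+
    thus False using s d(4-6) x0 y0 z0 by auto
  qed
  have F15: False if "i = 1" "j = 5"
  proof -
    have "d1 = s * (x)" "d2 = s * (- (x))" "d3 = s * (-x)"
      unfolding d(1-3) that cs by (rule refl)+
    thus False using s d(4-6) x0 y0 z0 by auto
  qed
  have F16: False if "i = 1" "j = 6"
  proof -
    have "d1 = s * (y)" "d2 = s * (- (-z-x))" "d3 = s * (-x)"
      unfolding d(1-3) that cs by (rule refl)+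
    thus False using s d(4-6) x0 y0 z0 by auto
  qed
  have F23: False if "i = 2" "j = 3"
  proof -
    have "d1 = s * (-z)" "d2 = s * (- (-z))" "d3 = s * (z)"
      unfolding d(1-3) that cs by (rule refl)+
    thus False using s d(4-6) x0 y0 z0 by auto
  qed
  have F24: False if "i = 2" "j = 4"
  proof -
    have "d1 = s * (y+z)" "d2 = s * (- (z-x))" "d3 = s * (z)"
      unfolding d(1-3) that cs by (rule refl)+
    thus False using s d(4-6) x0 y0 z0 by auto
  qed
  have F25: False if "i = 2" "j = 5"
  proof -
    have "d1 = s * (-y-z)" "d2 = s * (- (x))" "d3 = s * (z)"
      unfolding d(1-3) that cs by (rule refl)+
    thus False using s d(4-6) x0 y0 z0 by auto
  qed
  have F35: False if "i = 3" "j = 5"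
  proof -
    have "d1 = s * (x+y+z)" "d2 = s * (- (x))" "d3 = s * (-z)"
      unfolding d(1-3) that cs by (rule refl)+
    thus False using s d(4-6) x0 y0 z0 by auto
  qed
  have F36: False if "i = 3" "j = 6"
  proof -
    have "d1 = s * (-x-y-z)" "d2 = s * (- (-z-x))" "d3 = s * (-z)"
      unfolding d(1-3) that cs by (rule refl)+
    thus False using s d(4-6) x0 y0 z0 by auto
  qed
  have F45: False if "i = 4" "j = 5"
  proof -
    have "d1 = s * (-y-z)" "d2 = s * (- (x))" "d3 = s * (z-x)"
      unfolding d(1-3) that cs by (rule refl)+
    thus False using s d(4-6) x0 y0 z0 by auto
  qed
  have F56: False if "i = 5" "j = 6"
  proof -
    have "d1 = s * (-x-y-z)" "d2 = s * (- (-z-x))" "d3 = s * (x)"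
      unfolding d(1-3) that cs by (rule refl)+
    thus False using s d(4-6) x0 y0 z0 by auto
  qed
  \<comment> \<open>From here on all signs agree and growth decides: here z/x is at least 1.7, but
    fatness allows only 1.61.\<close>
  have F12: False if "i = 1" "j = 2"
  proof -
    have "d1 = s * (-y)" "d2 = s * (- (z))" "d3 = s * (-x)"
      unfolding d(1-3) that cs by (rule refl)+
    hence "d1 = y" "d2 = z" "d3 = x" using s d(4-6) x0 y0 z0 by auto
    hence "100 * (z * y) \<le> 161 * (y * x)" using F2 that by (simp add: y_def)
    hence "y * (100 * z) \<le> y * (161 * x)" by (simp add: mult_ac)
    hence "100 * z \<le> 161 * x" using y0(1) by (simp only: mult_le_cancel_left_pos)
    thus False using x0 by linarith
  qed
  have F34: False if "i = 3" "j = 4"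
  proof -
    have "d1 = s * (-x-y)" "d2 = s * (- (z-x))" "d3 = s * (-z)"
      unfolding d(1-3) that cs by (rule refl)+
    hence "d1 = x+y" "d2 = z-x" "d3 = z" using s d(4-6) x0 y0 z0 by auto
    hence "100 * (z * (y+z)) \<le> 161 * ((x+y) * (z-x))" using F3 that p4 by simp
    also have "\<dots> \<le> 161 * ((x+y) * x)" using zx x0 y0 by (intro mult_left_mono) auto
    also have "\<dots> = x * (161 * (x+y))" by simp
    also have "17 * \<dots> \<le> 10 * z * (161 * (x+y))" using x0 y0 mult_right_mono[of "17*x" "10*z" "161*(x+y)"] by simp
    finally have "z * (1700 * (y+z)) \<le> z * (1610 * (x+y))" by (simp add: algebra_simps)
    hence "1700 * (y+z) \<le> 1610 * (x+y)" using z0(1) by (simp only: mult_le_cancel_left_pos)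
    moreover have "2890 * x \<le> 1700 * z" using x0(2) by simp
    ultimately show False using x0(1) y0(1) by simp
  qed
  have F14: False if "i = 1" "j = 4"
  proof -
    have "d1 = s * (-x-y)" "d2 = s * (- (z-x))" "d3 = s * (-x)"
      unfolding d(1-3) that cs by (rule refl)+
    hence "d1 = x+y" "d2 = z-x" "d3 = x" using s d(4-6) x0 y0 z0 by auto
    hence "x * (100 * (x+y)) \<le> x * (161 * (z-x))" using F1 by (simp add: x_def mult_ac)
    hence "100 * (x+y) \<le> 161 * (z-x)" using x0(1) by (simp only: mult_le_cancel_left_pos)
    hence "100*x + 100*y \<le> 161*z - 161*x" by simp
    moreover have "10*z \<le> 19*x" using zx by simp
    ultimately show False using x0 by linarith
  qed
  have F26: False if "i = 2" "j = 6"
  proof -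
    have "d1 = s * (y)" "d2 = s * (- (-z-x))" "d3 = s * (z)"
      unfolding d(1-3) that cs by (rule refl)+
    hence "d1 = y" "d2 = z+x" "d3 = z" using s d(4-6) x0 y0 z0 by auto
    hence "100 * (z * (x+2*y+z)) \<le> 161 * (y * (z+x))" using F3 that p6 by simp
    also have "\<dots> \<le> 161 * (y * (2*z))" using x0 y0 by (intro mult_left_mono) auto
    finally have "z * (100 * (x+2*y+z)) \<le> z * (322 * y)" by (simp add: mult_ac)
    hence "100 * (x+2*y+z) \<le> 322 * y" using z0(1) by (simp only: mult_le_cancel_left_pos)
    hence "100*x + 100*z \<le> 122*y" by simp
    thus False using y0 by linarith
  qed
  have F46: False if "i = 4" "j = 6"
  proof -
    have "d1 = s * (x+2*y+z)" "d2 = s * (- (-z-x))" "d3 = s * (z-x)"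
      unfolding d(1-3) that cs by (rule refl)+
    hence "d1 = x+2*y+z" "d2 = z+x" "d3 = z-x" using s d(4-6) x0 y0 z0 by auto
    hence "100 * ((x+2*y+z) * x) \<le> 161 * ((z+x) * (z-x))" using F1 by (simp add: x_def)
    also have "\<dots> \<le> 161 * ((z+x) * x)" using zx x0 y0 z0 by (intro mult_left_mono) auto
    finally have "x * (100 * (x+2*y+z)) \<le> x * (161 * (z+x))" by (simp add: mult_ac)
    hence "100 * (x+2*y+z) \<le> 161 * (z+x)" using x0(1) by (simp only: mult_le_cancel_left_pos)
    hence "200*y \<le> 61*x+61*z" by simp
    moreover have "10*z \<le> 19*x" using zx by simp
    ultimately show False using x0 by linarith
  qed
  from exponent_pairs[OF ij] show False
    by (elim disjE conjE) (erule (1) F12 | erule (1) F13 | erule (1) F14 | erule (1) F15 | erule (1) F16 | erule (1) F23 | erule (1) F24 | erule (1) F25 | erule (1) F26 | erule (1) F34 | erule (1) F35 | erule (1) F36 | erule (1) F45 | erule (1) F46 | erule (1) F56)+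
qed

text \<open>Smallest exponents up to 11 fall under the finite check, by the gap bound 16; beyond,
  the gap is at most 6 and the Padovan patterns apply.\<close>

lemma unit_triple_ordered: fixes s d1 d2 d3 :: int
  assumes ord: "1 \<le> a" "a < b" "b < c" and s: "s = 1 \<or> s = -1"
   and d: "d1 = s * ucross b c" "d2 = s * ucross c a" "d3 = s * ucross a b" "0 < d1" "0 < d2" "0 < d3"
   and st: "d1 * phi^a + d2 * phi^b + d3 * phi^c = 1"
   and sc: "d1 * ucoord (a+1) + d2 * ucoord (b+1) + d3 * ucoord (c+1) = 1"
   and f1: "d1^2 * unorm2 a \<le> 1.50362 * (d1*d2*d3)"
   and f2: "d2^2 * unorm2 b \<le> 1.50362 * (d1*d2*d3)"
   and f3: "d3^2 * unorm2 c \<le> 1.50362 * (d1*d2*d3)"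
  shows False
proof (cases "a \<le> 11")
  case False
  have D: "0 < d1*d2*d3" using d by simp
  have g1: "(real_of_int d1)^2 * qf (ucoord (a+2)) (ucoord a) \<le> 5 * (real_of_int d1 * d2 * d3)"
    using fat_qf[of d1 "ucoord (a+2)" "ucoord a" "d1*d2*d3"] f1 D unfolding unorm2_def by simp
  have g2: "(real_of_int d2)^2 * qf (ucoord (b+2)) (ucoord b) \<le> 5 * (real_of_int d1 * d2 * d3)"
    using fat_qf[of d2 "ucoord (b+2)" "ucoord b" "d1*d2*d3"] f2 D unfolding unorm2_def by simp
  have g3: "(real_of_int d3)^2 * qf (ucoord (c+2)) (ucoord c) \<le> 5 * (real_of_int d1 * d2 * d3)"
    using fat_qf[of d3 "ucoord (c+2)" "ucoord c" "d1*d2*d3"] f3 D unfolding unorm2_def by simp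
  have c6: "c \<le> a + 6"
    by (rule exponent_spread_large[of d1 d2 d3 a b c]) (use d(4-6) ord False st g1 g2 g3 in simp_all)
  define i j where "i = b - a" and "j = c - a"
  have bc: "b = a + i" "c = a + j" using ord by (auto simp: i_def j_def)
  show False
  proof (rule no_fat_pad_pattern[of a i j s d1 d2 d3])
    show "100 * (d1 * pad a) \<le> 161 * (d2 * d3)" using fat_pad[of a d1 d2 d3] d False g1 by simp
    show "100 * (d2 * pad (a+i)) \<le> 161 * (d1 * d3)" using fat_pad[of "a+i" d2 d1 d3] d False g2 bc by (simp add: mult_ac)
    show "100 * (d3 * pad (a+j)) \<le> 161 * (d1 * d2)" using fat_pad[of "a+j" d3 d1 d2] d False g3 bc by (simp add: mult_ac)
  qed (use d s c6 bc ord False in auto)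
next
  case True
  have D: "0 < d1*d2*d3" using d by simp
  have h: "100000 * X \<le> 150362 * Y" if "real_of_int X \<le> 1.50362 * real_of_int Y" for X Y :: int
  proof -
    have "100000 * real_of_int X \<le> 150362 * real_of_int Y" using that by simp
    thus ?thesis by linarith
  qed
  have c16: "c \<le> a + 16"
  proof (rule exponent_spread[of d1 d2 d3 a b c])
    show "(real_of_int d2)^2 * qf (ucoord (b+2)) (ucoord b) \<le> 5 * (real_of_int d1 * d2 * d3)"
      using fat_qf[of d2 "ucoord (b+2)" "ucoord b" "d1*d2*d3"] f2 D unfolding unorm2_def by simp
    show "(real_of_int d3)^2 * qf (ucoord (c+2)) (ucoord c) \<le> 5 * (real_of_int d1 * d2 * d3)"
      using fat_qf[of d3 "ucoord (c+2)" "ucoord c" "d1*d2*d3"] f3 D unfolding unorm2_def by simp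
  qed (use d(4-6) ord st in simp_all)
  have "fat3 (uvec a) (uvec b) (uvec c)"
  proof -
    have ss: "s * s = 1" using s by auto
    let ?e1 = "ucross b c" and ?e2 = "ucross c a" and ?e3 = "ucross a b"
    have e: "?e1 = s * d1" "?e2 = s * d2" "?e3 = s * d3" using d ss by (simp_all flip: mult.assoc)
    have p: "0 < ?e1 * ?e2" "0 < ?e1 * ?e3"
    proof -
      have "?e1 * ?e2 = (s * s) * (d1*d2)" "?e1 * ?e3 = (s * s) * (d1*d3)" unfolding e by (simp_all add: mult_ac)
      thus "0 < ?e1 * ?e2" "0 < ?e1 * ?e3" using ss d(4-6) by simp_all
    qed
    have "?e1 * ucoord (a+1) + ?e2 * ucoord (b+1) + ?e3 * ucoord (c+1) = s * (d1 * ucoord (a+1) + d2 * ucoord (b+1) + d3 * ucoord (c+1))"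
      unfolding e by (simp add: algebra_simps)
    hence u: "\<bar>?e1 * ucoord (a+1) + ?e2 * ucoord (b+1) + ?e3 * ucoord (c+1)\<bar> = 1" using sc s by auto
    have sq: "?e1 * ?e1 = d1^2" "?e2 * ?e2 = d2^2" "?e3 * ?e3 = d3^2"
      unfolding e using s by (auto simp: power2_eq_square)
    have ab: "\<bar>?e1 * ?e2 * ?e3\<bar> = d1 * d2 * d3" unfolding e using s d(4-6) by (auto simp: abs_mult)
    have es: "unorm2 k = ucoord (k+2) * ucoord (k+2) + ucoord k * ucoord k" for k by (simp add: unorm2_def power2_eq_square)
    have i: "100000 * (d1^2 * unorm2 a) \<le> 150362 * (d1*d2*d3)" "100000 * (d2^2 * unorm2 b) \<le> 150362 * (d1*d2*d3)"
      "100000 * (d3^2 * unorm2 c) \<le> 150362 * (d1*d2*d3)"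
      using f1 f2 f3 by (simp_all add: h)
    show ?thesis unfolding uvec_def fat3.simps Let_def ucross_def[symmetric]
        es[symmetric] sq ab using p u i by simp
  qed
  thus False using no_fat_small[of a b c] ord True c16 by simp
qed

text \<open>Sorting the exponents: cyclic rotations keep \<open>s\<close> and odd permutations
  reverse it, because \<open>ucross\<close> is antisymmetric.\<close>

lemma unit_triple: fixes s d1 d2 d3 :: int
  assumes ge: "1 \<le> a" "1 \<le> b" "1 \<le> c" and s: "s = 1 \<or> s = -1"
   and d: "d1 = s * ucross b c" "d2 = s * ucross c a" "d3 = s * ucross a b" "0 < d1" "0 < d2" "0 < d3"
   and st: "d1 * phi^a + d2 * phi^b + d3 * phi^c = 1"
   and sc: "d1 * ucoord (a+1) + d2 * ucoord (b+1) + d3 * ucoord (c+1) = 1"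
   and f1: "d1^2 * unorm2 a \<le> 1.50362 * (d1*d2*d3)"
   and f2: "d2^2 * unorm2 b \<le> 1.50362 * (d1*d2*d3)"
   and f3: "d3^2 * unorm2 c \<le> 1.50362 * (d1*d2*d3)"
  shows False
proof -
  have ne: "a \<noteq> b" "b \<noteq> c" "a \<noteq> c" using d ucross_self by auto
  have s': "- s = 1 \<or> - s = -1" using s by auto
  have d': "d1 = (-s) * ucross c b" "d2 = (-s) * ucross a c" "d3 = (-s) * ucross b a"
    using d ucross_swap[of b c] ucross_swap[of c a] ucross_swap[of a b] by auto
  consider "a < b \<and> b < c" | "b < c \<and> c < a" | "c < a \<and> a < b"
    | "b < a \<and> a < c" | "a < c \<and> c < b" | "c < b \<and> b < a" using ne by linarith
  then show False
  proof cases
    case 1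
    then show False using unit_triple_ordered[of a b c s d1 d2 d3] ge s d st sc f1 f2 f3 by blast
  next
    case 2
    show False by (rule unit_triple_ordered[of b c a s d2 d3 d1])
      (use 2 ge s d(1-3) in \<open>simp; fail\<close> | use d(4-6) st sc f1 f2 f3 in \<open>simp add: mult_ac add_ac\<close>)+
  next
    case 3
    show False by (rule unit_triple_ordered[of c a b s d3 d1 d2])
      (use 3 ge s d(1-3) in \<open>simp; fail\<close> | use d(4-6) st sc f1 f2 f3 in \<open>simp add: mult_ac add_ac\<close>)+
  next
    case 4
    show False by (rule unit_triple_ordered[of b a c "-s" d2 d1 d3])
      (use 4 ge s' d' in \<open>simp; fail\<close> | use d(4-6) st sc f1 f2 f3 in \<open>simp add: mult_ac add_ac\<close>)+
  next
    case 5
    show False by (rule unit_triple_ordered[of a c b "-s" d1 d3 d2])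
      (use 5 ge s' d' in \<open>simp; fail\<close> | use d(4-6) st sc f1 f2 f3 in \<open>simp add: mult_ac add_ac\<close>)+
  next
    case 6
    show False by (rule unit_triple_ordered[of c b a "-s" d3 d2 d1])
      (use 6 ge s' d' in \<open>simp; fail\<close> | use d(4-6) st sc f1 f2 f3 in \<open>simp add: mult_ac add_ac\<close>)+
  qed
qed

text \<open>Infinite descent modulo 2.\<close>

lemma lin_eq_0: assumes "lin a b c = 0" shows "a = 0 \<and> b = 0 \<and> c = 0"
  using assms
proof (induction "nat (\<bar>a\<bar> + \<bar>b\<bar> + \<bar>c\<bar>)" arbitrary: a b c rule: less_induct)
  case less
  have "real_of_int (nrm a b c) = 0" unfolding nrm_eq less(2) by simp
  hence "even (nrm a b c)" by simp
  then obtain i j k where e: "a = 2*i" "b = 2*j" "c = 2*k" using even_nrm by (meson evenE)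
  have "2 * lin i j k = lin a b c" unfolding e by (simp add: lin_def)
  hence l: "lin i j k = 0" using less(2) by simp
  show ?case
  proof (rule ccontr)
    assume ne: "\<not> ?thesis"
    hence "nat (\<bar>i\<bar> + \<bar>j\<bar> + \<bar>k\<bar>) < nat (\<bar>a\<bar> + \<bar>b\<bar> + \<bar>c\<bar>)" unfolding e by auto
    from less(1)[OF this l] show False using ne e by auto
  qed
qed

text \<open>Each barycentric coordinate \<open>d * lin\<close> is below 1, hence so is each norm-one
  element, and \<open>unit_classification\<close> yields positive exponents.\<close>

lemma no_fat_triple: fixes s d1 d2 d3 a1 b1 c1 a2 b2 c2 a3 b3 c3 :: int
  assumes s: "s = 1 \<or> s = -1"
   and d: "d1 = s * (a2*b3 - b2*a3)" "d2 = s * (a3*b1 - b3*a1)" "d3 = s * (a1*b2 - b1*a2)"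
   and dp: "0 < d1" "0 < d2" "0 < d3"
   and sc: "d1*c1 + d2*c2 + d3*c3 = 1"
   and t: "0 < lin a1 b1 c1" "0 < lin a2 b2 c2" "0 < lin a3 b3 c3"
   and f: "d1^2*(a1^2+b1^2) \<le> 1.50362*(d1*d2*d3)" "d2^2*(a2^2+b2^2) \<le> 1.50362*(d1*d2*d3)"
       "d3^2*(a3^2+b3^2) \<le> 1.50362*(d1*d2*d3)"
  shows False
proof -
  have sa: "d1*a1 + d2*a2 + d3*a3 = 0" and sb: "d1*b1 + d2*b2 + d3*b3 = 0" unfolding d by algebra+
  have cr3: "\<bar>a1*b2 - b1*a2\<bar> = d3" using s d(3) dp(3) by auto
  have st: "d1 * lin a1 b1 c1 + d2 * lin a2 b2 c2 + d3 * lin a3 b3 c3 = 1"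
  proof -
    have "d1 * lin a1 b1 c1 + d2 * lin a2 b2 c2 + d3 * lin a3 b3 c3
      = real_of_int (d1*a1 + d2*a2 + d3*a3) * phi^2 + real_of_int (d1*b1 + d2*b2 + d3*b3) * phi + real_of_int (d1*c1 + d2*c2 + d3*c3)"
      by (simp add: lin_def algebra_simps)
    thus ?thesis unfolding sa sb sc by simp
  qed
  \<comment> \<open>A common divisor of one row divides the two multipliers formed from that row,
    hence every summand of \<open>sc\<close>.\<close>
  have prim: "\<not> (k dvd a1 \<and> k dvd b1 \<and> k dvd c1)" "\<not> (k dvd a2 \<and> k dvd b2 \<and> k dvd c2)" "\<not> (k dvd a3 \<and> k dvd b3 \<and> k dvd c3)"
    if "\<not> k dvd 1" for k :: int
  proof -
    have "k dvd d1*c1 + d2*c2 + d3*c3" if "k dvd a1 \<and> k dvd b1 \<and> k dvd c1" using that unfolding d by (intro dvd_add) auto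
    thus "\<not> (k dvd a1 \<and> k dvd b1 \<and> k dvd c1)" using \<open>\<not> k dvd 1\<close> sc by auto
    have "k dvd d1*c1 + d2*c2 + d3*c3" if "k dvd a2 \<and> k dvd b2 \<and> k dvd c2" using that unfolding d by (intro dvd_add) auto
    thus "\<not> (k dvd a2 \<and> k dvd b2 \<and> k dvd c2)" using \<open>\<not> k dvd 1\<close> sc by auto
    have "k dvd d1*c1 + d2*c2 + d3*c3" if "k dvd a3 \<and> k dvd b3 \<and> k dvd c3" using that unfolding d by (intro dvd_add) auto
    thus "\<not> (k dvd a3 \<and> k dvd b3 \<and> k dvd c3)" using \<open>\<not> k dvd 1\<close> sc by auto
  qed
  have n: "nrm a1 b1 c1 = 1 \<and> nrm a2 b2 c2 = 1 \<and> nrm a3 b3 c3 = 1"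
    by (rule all_norms_one[OF dp sa sb cr3 t st _ _ _ f]; rule nrm_eq_1_or_ge_5; (rule t prim)?; simp)
  have lt1: "lin a b c < 1" if "real_of_int e * lin a b c < 1" "0 < e" "0 < lin a b c" for e a b c
  proof -
    have "1 * lin a b c \<le> real_of_int e * lin a b c" using that by (intro mult_right_mono) auto
    thus ?thesis using that by linarith
  qed
  have pos: "0 < d1 * lin a1 b1 c1" "0 < d2 * lin a2 b2 c2" "0 < d3 * lin a3 b3 c3" using t dp by auto
  have "lin a1 b1 c1 < 1" using lt1[of d1 a1 b1 c1] pos st dp t by linarith
  then obtain i where i: "1 \<le> i" "a1 = ucoord (i+2)" "b1 = ucoord i" "c1 = ucoord (i+1)"
    using unit_classification n t by metis
  have "lin a2 b2 c2 < 1" using lt1[of d2 a2 b2 c2] pos st dp t by linarith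
  then obtain j where j: "1 \<le> j" "a2 = ucoord (j+2)" "b2 = ucoord j" "c2 = ucoord (j+1)"
    using unit_classification n t by metis
  have "lin a3 b3 c3 < 1" using lt1[of d3 a3 b3 c3] pos st dp t by linarith
  then obtain k where k: "1 \<le> k" "a3 = ucoord (k+2)" "b3 = ucoord k" "c3 = ucoord (k+1)"
    using unit_classification n t by metis
  show False
  proof (rule unit_triple[OF i(1) j(1) k(1) s _ _ _ dp])
    show "d1 = s * ucross j k" "d2 = s * ucross k i" "d3 = s * ucross i j" using d unfolding i j k ucross_def by auto
    show "d1 * phi^i + d2 * phi^j + d3 * phi^k = 1" using st unfolding i j k lin_unit .
    show "d1 * ucoord (i+1) + d2 * ucoord (j+1) + d3 * ucoord (k+1) = 1" using sc unfolding i j k .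
    show "d1^2 * unorm2 i \<le> 1.50362 * (d1*d2*d3)" "d2^2 * unorm2 j \<le> 1.50362 * (d1*d2*d3)" "d3^2 * unorm2 k \<le> 1.50362 * (d1*d2*d3)"
      using f unfolding i j k unorm2_def by simp_all
  qed
qed

section \<open>Unimodular triangles\<close>

text \<open>Twice the signed area, in the form in which \<open>content_triangle\<close> states
  it.\<close>

definition cross :: "real^2 \<Rightarrow> real^2 \<Rightarrow> real^2 \<Rightarrow> real" where
  "cross a b c = (c$1 - a$1) * (b$2 - a$2) - (b$1 - a$1) * (c$2 - a$2)"

lemma dist_sq_2: "(dist a b)^2 = (a$1 - b$1)^2 + (a$2 - b$2)^2" for a b :: "real^2"
  unfolding dist_norm power2_norm_eq_inner inner_vec_def sum_2 by (simp add: power2_eq_square)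

text \<open>\<open>P\<close> and |\<open>X\<close>| are the product of the two sides times cosine
  and sine of the angle. The threshold angle has cosine (13/36)^(1/2), hence cotangent
  (13/23)^(1/2), rounded up to 0.75181.\<close>

lemma angle_bound: fixes a b c :: "real^2"
  assumes ne: "a \<noteq> b" "a \<noteq> c" and ang: "angle_at a b c > arcsin (sqrt 23 / 6)"
  shows "(b - a) \<bullet> (c - a) \<le> 0.75181 * \<bar>cross a b c\<bar>"
proof -
  define P X where "P = (b - a) \<bullet> (c - a)" and "X = cross a b c"
  define N where "N = dist a b * dist a c"
  have N0: "0 < N" using ne by (simp add: N_def)
  have N2: "N^2 = P^2 + X^2"
    unfolding N_def power_mult_distrib dist_sq_2 P_def X_def cross_def
    by (simp add: inner_vec_def sum_2 power2_eq_square algebra_simps)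
  have PN: "\<bar>P / N\<bar> \<le> 1"
  proof -
    have "P^2 \<le> N^2" using N2 by simp
    hence "\<bar>P\<bar> \<le> N" using N0 abs_le_square_iff[of P N] by simp
    thus ?thesis using N0 by simp
  qed
  have s: "sqrt 23 / 6 \<le> 1" by (simp add: real_le_lsqrt)
  have "cos (arccos (P / N)) < cos (arcsin (sqrt 23 / 6))"
  proof (rule cos_monotone_0_pi)
    show "0 \<le> arcsin (sqrt 23 / 6)" using s by (simp add: arcsin_nonneg)
    show "arcsin (sqrt 23 / 6) < arccos (P / N)" using ang by (simp add: angle_at_def P_def N_def)
    show "arccos (P / N) \<le> pi" using PN by (intro arccos_ubound) linarith+
  qed
  also have "cos (arcsin (sqrt 23 / 6)) = sqrt (13/36)"
  proof -
    have "cos (arcsin (sqrt 23 / 6)) = sqrt (1 - (sqrt 23 / 6)^2)" using s by (intro cos_arcsin) (auto intro: order_trans[of _ 0])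
    thus ?thesis by (simp add: power_divide)
  qed
  finally have "P / N < sqrt (13/36)" using PN by (simp add: cos_arccos_abs)
  hence PN: "P < sqrt (13/36) * N" using N0 by (simp add: pos_divide_less_eq)
  have "P \<le> 0.75181 * \<bar>X\<bar>"
  proof (cases "P \<le> 0")
    case False
    have "P^2 < (sqrt (13/36) * N)^2" using PN False by (intro power_strict_mono) auto
    hence "P^2 < 13/36 * (P^2 + X^2)" unfolding N2[symmetric] power_mult_distrib by simp
    hence "P^2 \<le> 13/23 * X^2" by simp
    also have "13/23 * X^2 \<le> 0.75181^2 * X^2" by (intro mult_right_mono) (auto simp: power2_eq_square)
    finally have "P^2 \<le> (0.75181 * \<bar>X\<bar>)^2" unfolding power_mult_distrib power2_abs .
    thus ?thesis using abs_le_square_iff[of P "0.75181 * \<bar>X\<bar>"] by simp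
  qed auto
  thus ?thesis by (simp add: P_def X_def)
qed

text \<open>A side is the sum of the signed projections of the other two onto it.\<close>

lemma side_bound: fixes a b c :: "real^2"
  assumes ne: "a \<noteq> b" "a \<noteq> c" "b \<noteq> c"
   and ang: "angle_at a b c > arcsin (sqrt 23 / 6)" "angle_at b a c > arcsin (sqrt 23 / 6)"
  shows "(dist a b)^2 \<le> 1.50362 * \<bar>cross a b c\<bar>"
proof -
  have "cross b a c = - cross a b c" unfolding cross_def by algebra
  hence "(b - a) \<bullet> (c - a) + (a - b) \<bullet> (c - b) \<le> 1.50362 * \<bar>cross a b c\<bar>"
    using angle_bound[of a b c] angle_bound[of b a c] assms by simp
  moreover have "(b - a) \<bullet> (c - a) + (a - b) \<bullet> (c - b) = (dist a b)^2"
    unfolding dist_sq_2 by (simp add: inner_vec_def sum_2 power2_eq_square algebra_simps)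
  ultimately show ?thesis by simp
qed

lemma vertex_nth: "vertex M i $ 1 = M$i$1 / denom M i" "vertex M i $ 2 = M$i$2 / denom M i"
  by (simp_all add: vertex_def)

definition dprod :: "int^3^3 \<Rightarrow> int" where "dprod M = denom M 1 * denom M 2 * denom M 3"

lemma cross_vertex: assumes "\<forall>i. denom M i > 0" "det M = 1 \<or> det M = -1"
  shows "\<bar>cross (vertex M 1) (vertex M 2) (vertex M 3)\<bar> = 1 / dprod M"
proof -
  have dp: "real_of_int (denom M i) \<noteq> 0" for i using assms(1) by (metis less_irrefl of_int_eq_0_iff)
  have pos: "0 < real_of_int (dprod M)" using assms(1) by (simp add: dprod_def)
  have "real_of_int (dprod M) * cross (vertex M 1) (vertex M 2) (vertex M 3) = - real_of_int (det M)"
    unfolding cross_def vertex_nth dprod_def det_3 using dp[of 1] dp[of 2] dp[of 3]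
    by (simp add: field_simps denom_def)
  hence "real_of_int (dprod M) * \<bar>cross (vertex M 1) (vertex M 2) (vertex M 3)\<bar> = 1"
    using assms(2) pos by (metis abs_minus abs_mult abs_of_pos abs_one of_int_1 of_int_minus)
  thus ?thesis using pos by (simp add: field_simps)
qed

text \<open>The triple consists of the rows of the inverse transpose of \<open>M\<close>, read as linear forms; their values at
  \<open>(x, 1)\<close> are the barycentric coordinates of \<open>x\<close> divided by the denominators.\<close>

lemma no_fat_unimodular: fixes m :: int
  assumes uc: "unimodular_coords T M" and x: "x \<in> T" "x $ 1 = phi^2 + m" "x $ 2 = phi"
   and f: "(dist (vertex M 2) (vertex M 3))^2 \<le> 1.50362 / dprod M"
     "(dist (vertex M 3) (vertex M 1))^2 \<le> 1.50362 / dprod M"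
     "(dist (vertex M 1) (vertex M 2))^2 \<le> 1.50362 / dprod M"
  shows False
proof -
  define p1 p2 p3 q1 q2 q3 d1 d2 d3 where "p1 = M$1$1" and "p2 = M$2$1" and "p3 = M$3$1"
    and "q1 = M$1$2" and "q2 = M$2$2" and "q3 = M$3$2" and "d1 = denom M 1" and "d2 = denom M 2" and "d3 = denom M 3"
  note defs = p1_def p2_def p3_def q1_def q2_def q3_def d1_def d2_def d3_def
  define s where "s = det M"
  have s: "s = 1 \<or> s = -1" using uc by (simp add: unimodular_coords_def s_def)
  hence ss: "s * s = 1" by auto
  have se: "s = p1*(q2*d3 - q3*d2) + q1*(d2*p3 - p2*d3) + d1*(p2*q3 - q2*p3)"
    unfolding s_def det_3 defs denom_def by algebra
  have dp: "0 < d1" "0 < d2" "0 < d3" using uc by (simp_all add: unimodular_coords_def defs)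
  have D: "dprod M = d1*d2*d3" by (simp add: dprod_def defs)
  \<comment> \<open>The summands \<open>m * a1\<close> and so on translate the point to
    \<open>(phi^2, phi)\<close>, where the forms become values of \<open>lin\<close>.\<close>
  define a1 b1 c1 where "a1 = s * (q2*d3 - q3*d2)" and "b1 = s * (d2*p3 - p2*d3)" and "c1 = s * (p2*q3 - q2*p3) + m * a1"
  define a2 b2 c2 where "a2 = s * (q3*d1 - q1*d3)" and "b2 = s * (d3*p1 - p3*d1)" and "c2 = s * (p3*q1 - q3*p1) + m * a2"
  define a3 b3 c3 where "a3 = s * (q1*d2 - q2*d1)" and "b3 = s * (d1*p2 - p1*d2)" and "c3 = s * (p1*q2 - q1*p2) + m * a3"
  note ndefs = a1_def b1_def c1_def a2_def b2_def c2_def a3_def b3_def c3_def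
  have T: "T = convex hull {vertex M 1, vertex M 2, vertex M 3}" using uc by (simp add: unimodular_coords_def is_triangle_def)
  obtain u y w where uvw: "0 \<le> u" "0 \<le> y" "0 \<le> w" "u + y + w = 1"
    and xe: "x = u *\<^sub>R vertex M 1 + y *\<^sub>R vertex M 2 + w *\<^sub>R vertex M 3"
    using x(1) unfolding T convex_hull_3 by auto
  have x1: "phi^2 + m = u*p1/d1 + y*p2/d2 + w*p3/d3" and x2: "phi = u*q1/d1 + y*q2/d2 + w*q3/d3"
    using x(2,3) unfolding xe by (simp_all add: vertex_nth defs)
  have dd: "s * (a2*b3 - b2*a3) = d1" "s * (a3*b1 - b3*a1) = d2" "s * (a1*b2 - b1*a2) = d3"
  proof -
    have "s * (a2*b3 - b2*a3) = (s * s) * s * (s * d1)"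
      by (subst (4) se) (unfold ndefs, algebra)
    thus "s * (a2*b3 - b2*a3) = d1" using ss by (simp add: mult.assoc[symmetric])
    have "s * (a3*b1 - b3*a1) = (s * s) * s * (s * d2)"
      by (subst (4) se) (unfold ndefs, algebra)
    thus "s * (a3*b1 - b3*a1) = d2" using ss by (simp add: mult.assoc[symmetric])
    have "s * (a1*b2 - b1*a2) = (s * s) * s * (s * d3)"
      by (subst (4) se) (unfold ndefs, algebra)
    thus "s * (a1*b2 - b1*a2) = d3" using ss by (simp add: mult.assoc[symmetric])
  qed
  \<comment> \<open>Duality between the rows of \<open>M\<close> and of its inverse transpose, with
    the translation by \<open>m\<close> undone.\<close>
  have bil: "a1*p1 + b1*q1 + (c1 - m*a1)*d1 = 1" "a1*p2 + b1*q2 + (c1 - m*a1)*d2 = 0" "a1*p3 + b1*q3 + (c1 - m*a1)*d3 = 0"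
     "a2*p1 + b2*q1 + (c2 - m*a2)*d1 = 0" "a2*p2 + b2*q2 + (c2 - m*a2)*d2 = 1" "a2*p3 + b2*q3 + (c2 - m*a2)*d3 = 0"
     "a3*p1 + b3*q1 + (c3 - m*a3)*d1 = 0" "a3*p2 + b3*q2 + (c3 - m*a3)*d2 = 0" "a3*p3 + b3*q3 + (c3 - m*a3)*d3 = 1"
  proof -
    have "a1*p1 + b1*q1 + (c1 - m*a1)*d1 = s * (p1*(q2*d3 - q3*d2) + q1*(d2*p3 - p2*d3) + d1*(p2*q3 - q2*p3))"
      "a2*p2 + b2*q2 + (c2 - m*a2)*d2 = s * (p1*(q2*d3 - q3*d2) + q1*(d2*p3 - p2*d3) + d1*(p2*q3 - q2*p3))"
      "a3*p3 + b3*q3 + (c3 - m*a3)*d3 = s * (p1*(q2*d3 - q3*d2) + q1*(d2*p3 - p2*d3) + d1*(p2*q3 - q2*p3))"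
      unfolding ndefs by algebra+
    thus "a1*p1 + b1*q1 + (c1 - m*a1)*d1 = 1" "a2*p2 + b2*q2 + (c2 - m*a2)*d2 = 1" "a3*p3 + b3*q3 + (c3 - m*a3)*d3 = 1"
      unfolding se[symmetric] ss .
  qed (unfold ndefs, algebra+)
  have lin_eq: "lin a b c = u * ((a*p1 + b*q1 + (c - m*a)*d1) / d1) + y * ((a*p2 + b*q2 + (c - m*a)*d2) / d2) + w * ((a*p3 + b*q3 + (c - m*a)*d3) / d3)"
    for a b c
  proof -
    have r: "real_of_int d1 \<noteq> 0" "real_of_int d2 \<noteq> 0" "real_of_int d3 \<noteq> 0" using dp by auto
    have e: "u * ((a*p + b*q + g*d) / d) = a * (u*p/d) + b * (u*q/d) + g * u" if "d \<noteq> 0" for u a p b q g d :: real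
      using that by (simp add: field_simps)
    have "lin a b c = a * (phi^2 + m) + b * phi + (c - m*a) * (u + y + w)" unfolding uvw(4) by (simp add: lin_def algebra_simps)
    also have "\<dots> = a * (u*p1/d1 + y*p2/d2 + w*p3/d3) + b * (u*q1/d1 + y*q2/d2 + w*q3/d3) + (c - m*a) * (u + y + w)"
      using x1 x2 by simp
    also have "\<dots> = u * ((a*p1 + b*q1 + (c - m*a)*d1) / d1) + y * ((a*p2 + b*q2 + (c - m*a)*d2) / d2) + w * ((a*p3 + b*q3 + (c - m*a)*d3) / d3)"
      unfolding of_int_add of_int_mult of_int_diff e[OF r(1)] e[OF r(2)] e[OF r(3)] by (simp add: distrib_left)
    finally show ?thesis by simp
  qed
  have "lin a1 b1 c1 = u / d1" "lin a2 b2 c2 = y / d2" "lin a3 b3 c3 = w / d3"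
    unfolding lin_eq of_int_add[symmetric] of_int_mult[symmetric] of_int_diff[symmetric] bil by simp_all
  hence t0: "0 \<le> lin a1 b1 c1" "0 \<le> lin a2 b2 c2" "0 \<le> lin a3 b3 c3" using uvw dp by simp_all
  \<comment> \<open>The point lies on no edge: by \<open>lin_eq_0\<close> a vanishing value makes
    the whole triple zero, and with it some denominator.\<close>
  have t: "0 < lin a1 b1 c1" "0 < lin a2 b2 c2" "0 < lin a3 b3 c3"
  proof -
    have "d2 = 0" if "a1 = 0 \<and> b1 = 0 \<and> c1 = 0" using that dd(2) by simp
    moreover have "d3 = 0" if "a2 = 0 \<and> b2 = 0 \<and> c2 = 0" using that dd(3) by simp
    moreover have "d1 = 0" if "a3 = 0 \<and> b3 = 0 \<and> c3 = 0" using that dd(1) by simp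
    ultimately have "lin a1 b1 c1 \<noteq> 0" "lin a2 b2 c2 \<noteq> 0" "lin a3 b3 c3 \<noteq> 0" using dp lin_eq_0 less_irrefl by metis+
    thus "0 < lin a1 b1 c1" "0 < lin a2 b2 c2" "0 < lin a3 b3 c3" using t0 by linarith+
  qed
  have sc: "d1*c1 + d2*c2 + d3*c3 = 1"
  proof -
    have "d1*c1 + d2*c2 + d3*c3 = s * (p1*(q2*d3 - q3*d2) + q1*(d2*p3 - p2*d3) + d1*(p2*q3 - q2*p3))" unfolding ndefs by algebra
    thus ?thesis unfolding se[symmetric] ss .
  qed
  have fat: "d^2*(a^2+b^2) \<le> 1.50362*(d*e*g)"
    if "(dist (vertex M i) (vertex M j))^2 \<le> 1.50362 / (d*e*g)" "denom M i = e" "denom M j = g"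
      "a^2 + b^2 = (M$i$1*g - M$j$1*e)^2 + (M$i$2*g - M$j$2*e)^2" "0 < d" "0 < e" "0 < g" for i j and a b d e g :: int
  proof -
    have r: "real_of_int e \<noteq> 0" "real_of_int g \<noteq> 0" using that by auto
    have "(dist (vertex M i) (vertex M j))^2 = (real_of_int ((M$i$1*g - M$j$1*e)^2 + (M$i$2*g - M$j$2*e)^2)) / (e*g)^2"
      unfolding dist_sq_2 vertex_nth that(2,3) using r by (simp add: field_simps power2_eq_square)
    also have "\<dots> = real_of_int (a^2+b^2) / (e*g)^2" unfolding that(4) ..
    finally have "real_of_int (a^2+b^2) / (e*g)^2 \<le> 1.50362 / (d*e*g)" using that(1) by simp
    hence "real_of_int (a^2+b^2) / (e*g)^2 * (d*e*g)^2 \<le> 1.50362 / (d*e*g) * (d*e*g)^2"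
      by (intro mult_right_mono) auto
    also have "1.50362 / (d*e*g) * (d*e*g)^2 = 1.50362 * real_of_int (d*e*g)" using that(5-7) by (simp add: power2_eq_square)
    also have "real_of_int (a^2+b^2) / (e*g)^2 * (d*e*g)^2 = real_of_int (d^2*(a^2+b^2))"
      using r by (simp add: power_mult_distrib)
    finally show ?thesis by simp
  qed
  \<comment> \<open>Up to sign, \<open>(a1, b1)\<close> is the edge vector opposite the first
    vertex, turned by a right angle and multiplied by the denominators at its two ends.\<close>
  have sq1: "a1^2 + b1^2 = (p2*d3 - p3*d2)^2 + (q2*d3 - q3*d2)^2" "a2^2 + b2^2 = (p3*d1 - p1*d3)^2 + (q3*d1 - q1*d3)^2"
    "a3^2 + b3^2 = (p1*d2 - p2*d1)^2 + (q1*d2 - q2*d1)^2"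
    using s unfolding ndefs by (auto simp: power2_eq_square algebra_simps)
  show False
  proof (rule no_fat_triple[OF s dd[symmetric] dp sc t])
    show "d1^2*(a1^2+b1^2) \<le> 1.50362*(d1*d2*d3)"
      by (rule fat[of 2 3, OF _ d2_def[symmetric] d3_def[symmetric] sq1(1)[unfolded defs(1-6)] dp(1,2,3)]) (use f(1) in \<open>simp add: D\<close>)
    have "d2^2*(a2^2+b2^2) \<le> 1.50362*(d2*d3*d1)"
      by (rule fat[of 3 1, OF _ d3_def[symmetric] d1_def[symmetric] sq1(2)[unfolded defs(1-6)] dp(2,3,1)]) (use f(2) in \<open>simp add: D mult_ac\<close>)
    thus "d2^2*(a2^2+b2^2) \<le> 1.50362*(d1*d2*d3)" by (simp only: mult_ac)
    have "d3^2*(a3^2+b3^2) \<le> 1.50362*(d3*d1*d2)"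
      by (rule fat[of 1 2, OF _ d1_def[symmetric] d2_def[symmetric] sq1(3)[unfolded defs(1-6)] dp(3,1,2)]) (use f(3) in \<open>simp add: D mult_ac\<close>)
    thus "d3^2*(a3^2+b3^2) \<le> 1.50362*(d1*d2*d3)" by (simp only: mult_ac)
  qed
qed

section \<open>The points and their rank\<close>

definition plastic_point :: "int \<Rightarrow> real^2" where
  "plastic_point m = vector [phi^2 + m, phi]"

lemma plastic_point_nth: "plastic_point m $ 1 = phi^2 + m" "plastic_point m $ 2 = phi"
  by (simp_all add: plastic_point_def)

text \<open>The upper bound for the rank is an exchange argument, for which the scalars must form a
  field.\<close>

definition rat_scale :: "rat \<Rightarrow> real \<Rightarrow> real" where "rat_scale q r = of_rat q * r"

interpretation Zmod: module int_scale by (rule module_int_scale)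

interpretation Qvs: vector_space rat_scale
  by unfold_locales (auto simp: rat_scale_def algebra_simps of_rat_add of_rat_mult)

text \<open>Clearing denominators: \<open>k\<close> multiplies each numerator by the denominators of
  the other coefficients.\<close>

lemma int_dependent_if_rat_dependent: assumes "Qvs.dependent B" shows "Zmod.dependent B"
proof -
  obtain t u v where t: "finite t" "t \<subseteq> B" "(\<Sum>v\<in>t. rat_scale (u v) v) = 0" "v \<in> t" "u v \<noteq> 0"
    using assms unfolding Qvs.dependent_explicit by blast
  define den where "den = (\<lambda>w. snd (quotient_of (u w)))"
  define num where "num = (\<lambda>w. fst (quotient_of (u w)))"
  have den0: "0 < den w" for w unfolding den_def by (rule quotient_of_denom_pos')
  have uw: "u w = of_int (num w) / of_int (den w)" for w
    unfolding num_def den_def by (rule quotient_of_div) simp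
  define k where "k = (\<lambda>w. num w * (\<Prod>z\<in>t - {w}. den z))"
  have P: "real_of_int (k w) = of_rat (u w) * real_of_int (\<Prod>z\<in>t. den z)" if "w \<in> t" for w
  proof -
    have "(\<Prod>z\<in>t. den z) = den w * (\<Prod>z\<in>t - {w}. den z)" using t(1) that by (simp add: prod.remove)
    moreover have "real_of_rat (u w) = num w / den w" unfolding uw by (simp add: of_rat_divide)
    ultimately show ?thesis using den0[of w] by (simp add: k_def)
  qed
  have "(\<Sum>w\<in>t. int_scale (k w) w) = (\<Sum>w\<in>t. real_of_int (\<Prod>z\<in>t. den z) * rat_scale (u w) w)"
    by (intro sum.cong) (auto simp: int_scale_def rat_scale_def P)
  also have "\<dots> = real_of_int (\<Prod>z\<in>t. den z) * (\<Sum>w\<in>t. rat_scale (u w) w)" by (rule sum_distrib_left[symmetric])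
  also have "\<dots> = 0" unfolding t(3) by simp
  finally have "(\<Sum>w\<in>t. int_scale (k w) w) = 0" .
  moreover have "k v \<noteq> 0"
  proof -
    have "num v \<noteq> 0" using t(5) uw[of v] by auto
    moreover have "0 < (\<Prod>z\<in>t - {v}. den z)" by (intro prod_pos den0)
    ultimately show ?thesis by (simp add: k_def)
  qed
  ultimately show ?thesis unfolding Zmod.dependent_explicit using t(1,2,4) by blast
qed

lemma plastic_point_rank3: "rank3_point (plastic_point m)"
proof -
  define x1 x2 where "x1 = phi^2 + m" and "x2 = phi"
  have A: "coord_group (plastic_point m) = {of_int a * x1 + of_int b * x2 + of_int c |a b c :: int. True}"
    by (simp add: coord_group_def plastic_point_nth x1_def x2_def)
  have z: "a = 0 \<and> b = 0 \<and> c = 0" if "of_int a * x1 + of_int b * x2 + of_int c = 0" for a b c :: int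
  proof -
    have "lin a b (c + a * m) = 0" using that by (simp add: lin_def x1_def x2_def algebra_simps)
    from lin_eq_0[OF this] show ?thesis by auto
  qed
  have ne: "x1 \<noteq> x2" "x1 \<noteq> 1" "x2 \<noteq> 1" using z[of 1 "-1" 0] z[of 1 0 "-1"] z[of 0 1 "-1"] by auto
  let ?B = "{x1, x2, 1}"
  have c3: "card ?B = 3" using ne by simp
  have ind: "\<not> Zmod.dependent ?B"
  proof
    assume "Zmod.dependent ?B"
    then obtain u where u: "(\<Sum>v\<in>?B. int_scale (u v) v) = 0" "\<exists>v\<in>?B. u v \<noteq> 0"
      unfolding Zmod.dependent_finite[of ?B, simplified] by blast
    have "of_int (u x1) * x1 + of_int (u x2) * x2 + of_int (u 1) = 0"
      using u(1) ne by (simp add: int_scale_def add.assoc)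
    from z[OF this] u(2) show False by auto
  qed
  have sub: "?B \<subseteq> coord_group (plastic_point m)"
  proof -
    have "x1 \<in> coord_group (plastic_point m)" unfolding A
      by (rule CollectI, rule exI[of _ 1], rule exI[of _ 0], rule exI[of _ 0]) simp
    moreover have "x2 \<in> coord_group (plastic_point m)" unfolding A
      by (rule CollectI, rule exI[of _ 0], rule exI[of _ 1], rule exI[of _ 0]) simp
    moreover have "1 \<in> coord_group (plastic_point m)" unfolding A
      by (rule CollectI, rule exI[of _ 0], rule exI[of _ 0], rule exI[of _ 1]) simp
    ultimately show ?thesis by simp
  qed
  have bound: "finite B \<and> card B \<le> 3" if "B \<subseteq> coord_group (plastic_point m)" "\<not> Zmod.dependent B" for B
  proof -
    have sp: "B \<subseteq> Qvs.span ?B"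
    proof
      fix y assume "y \<in> B"
      with that(1) have "y \<in> coord_group (plastic_point m)" by (rule subsetD)
      then obtain a b c :: int where y: "y = of_int a * x1 + of_int b * x2 + of_int c" unfolding A by auto
      have "rat_scale (of_int a) x1 + rat_scale (of_int b) x2 + rat_scale (of_int c) 1 \<in> Qvs.span ?B"
        by (intro Qvs.span_add Qvs.span_scale Qvs.span_base) auto
      thus "y \<in> Qvs.span ?B" unfolding y by (simp add: rat_scale_def)
    qed
    have "\<not> Qvs.dependent B" using that(2) int_dependent_if_rat_dependent by blast
    from Qvs.independent_span_bound[OF _ this sp] have "finite B \<and> card B \<le> card ?B" by simp
    thus ?thesis using c3 by simp
  qed
  have "finite ?B" by simp
  then show ?thesis unfolding rank3_point_def has_rank_def using ind sub c3 bound by blast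
qed

section \<open>Sides, diameter and area of a triangle\<close>

lemma not_collinear_distinct: assumes "\<not> collinear {a, b, c}" shows "a \<noteq> b" "a \<noteq> c" "b \<noteq> c"
proof -
  have c2: "collinear {a, c}" "collinear {a, b}" by (rule collinear_2)+
  have "{a, a, c} = {a, c}" "{a, b, b} = {a, b}" "{a, b, a} = {a, b}" by blast+
  then show "a \<noteq> b" "a \<noteq> c" "b \<noteq> c" using assms c2 by fastforce+
qed

text \<open>The vertices are the extreme points of the hull.\<close>

lemma triangle_vertices_unique: assumes "is_triangle T a b c" "is_triangle T a' b' c'"
  shows "{a,b,c} = {a',b',c'}"
proof -
  have *: "{x. x extreme_point_of T} = {a,b,c}" if "is_triangle T a b c" for a b c
  proof -
    have nc: "\<not> collinear {a,b,c}" using that by (simp add: is_triangle_def)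
    hence "\<not> affine_dependent {a,b,c}" unfolding collinear_3_eq_affine_dependent by blast
    moreover have "T = convex hull {a,b,c}" using that by (simp add: is_triangle_def)
    ultimately show ?thesis using extreme_point_of_convex_hull_affine_independent by blast
  qed
  show ?thesis using *[OF assms(1)] *[OF assms(2)] by simp
qed

text \<open>This makes the set of sides finite, so that \<open>Max\<close> in
  \<open>triangle_diam\<close> is meaningful.\<close>

lemma triangle_sides_subset: assumes "is_triangle T a b c"
  shows "triangle_sides T \<subseteq> (\<lambda>(p,q). dist p q) ` ({a,b,c} \<times> {a,b,c})"
proof
  fix r assume "r \<in> triangle_sides T"
  then obtain p q s where r: "r = dist p q" "is_triangle T p q s" by (auto simp: triangle_sides_def)
  have "p \<in> {p,q,s}" "q \<in> {p,q,s}" by simp_all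
  hence "(p,q) \<in> {a,b,c} \<times> {a,b,c}" unfolding triangle_vertices_unique[OF r(2) assms] by (rule SigmaI)
  thus "r \<in> (\<lambda>(p,q). dist p q) ` ({a,b,c} \<times> {a,b,c})" using r(1) by (intro image_eqI[of _ _ "(p,q)"]) simp_all
qed

lemma is_triangle_perm: assumes "is_triangle T a b c"
  shows "is_triangle T b c a" "is_triangle T c a b" "is_triangle T b a c"
proof -
  have "{b,c,a} = {a,b,c}" "{c,a,b} = {a,b,c}" "{b,a,c} = {a,b,c}" by blast+
  then show "is_triangle T b c a" "is_triangle T c a b" "is_triangle T b a c"
    using assms by (simp_all only: is_triangle_def simp_thms)
qed

lemma triangle_diam_ge: assumes "is_triangle T a b c"
  shows "dist a b \<le> triangle_diam T"
proof -
  have "finite (triangle_sides T)" using triangle_sides_subset[OF assms] by (rule finite_subset) simp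
  moreover have "dist a b \<in> triangle_sides T" using assms by (auto simp: triangle_sides_def)
  ultimately show ?thesis by (simp add: triangle_diam_def)
qed

lemma triangle_diam_le: assumes "is_triangle T a b c"
  shows "triangle_diam T \<le> dist x a + dist x b + dist x c"
proof -
  have fin: "finite (triangle_sides T)" using triangle_sides_subset[OF assms] by (rule finite_subset) simp
  moreover have "dist a b \<in> triangle_sides T" using assms by (auto simp: triangle_sides_def)
  ultimately have "triangle_diam T \<in> triangle_sides T" unfolding triangle_diam_def by (intro Max_in) auto
  with triangle_sides_subset[OF assms] have "triangle_diam T \<in> (\<lambda>(p,q). dist p q) ` ({a,b,c} \<times> {a,b,c})"
    by (rule subsetD)
  then obtain p q where pq: "p \<in> {a,b,c}" "q \<in> {a,b,c}" "triangle_diam T = dist p q"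
    by (elim imageE SigmaE) simp
  have "dist a b \<le> dist x a + dist x b" "dist a c \<le> dist x a + dist x c" "dist b c \<le> dist x b + dist x c"
    by (metis dist_commute dist_triangle)+
  moreover have "dist p q \<in> {0, dist a b, dist a c, dist b c}" using pq by (auto simp: dist_commute)
  moreover have "0 \<le> dist x a" "0 \<le> dist x b" "0 \<le> dist x c" by simp_all
  ultimately show ?thesis unfolding pq(3) by (elim insertE emptyE) linarith+
qed

lemma unimodular_area: assumes "unimodular_coords T M"
  shows "triangle_area T = 1 / (2 * dprod M)" "0 < dprod M"
proof -
  have T: "T = convex hull {vertex M 1, vertex M 2, vertex M 3}"
    using assms by (simp add: unimodular_coords_def is_triangle_def)
  have "compact T" unfolding T by (intro finite_imp_compact_convex_hull) auto
  hence "T \<in> sets lborel" using borel_compact by simp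
  hence "measure lebesgue T = measure lborel T" by (rule measure_completion)
  also have "\<dots> = \<bar>cross (vertex M 1) (vertex M 2) (vertex M 3)\<bar> / 2" unfolding T cross_def by (rule content_triangle)
  also have "\<bar>cross (vertex M 1) (vertex M 2) (vertex M 3)\<bar> = 1 / dprod M"
    using assms by (intro cross_vertex) (simp_all add: unimodular_coords_def)
  also have "1 / real_of_int (dprod M) / 2 = 1 / (2 * dprod M)" by simp
  finally show "triangle_area T = 1 / (2 * dprod M)" by (simp add: triangle_area_def)
  show "0 < dprod M" using assms by (simp add: dprod_def unimodular_coords_def)
qed

lemma area_powr: assumes "unimodular_coords T M"
  shows "triangle_area T powr (1/2) = of_int (2 * denom M 1 * denom M 2 * denom M 3) powr (- 1 / 2)"
proof -
  have e: "2 * denom M 1 * denom M 2 * denom M 3 = 2 * dprod M" by (simp add: dprod_def)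
  define y where "y = real_of_int (2 * dprod M)"
  have y: "0 < y" using unimodular_area(2)[OF assms] by (simp add: y_def)
  have "triangle_area T = 1 / y" using unimodular_area(1)[OF assms] by (simp add: y_def)
  hence "triangle_area T powr (1/2) = y powr (- 1 / 2)" using y by (simp add: powr_minus_divide powr_divide)
  thus ?thesis unfolding e y_def .
qed

text \<open>By \<open>no_fat_unimodular\<close> some squared side exceeds 1.50362/D, which is
  3.00724 times the area, and 3.00724 rounds up 4 (13/23)^(1/2).\<close>

lemma diam_area_bound: assumes uc: "unimodular_coords T M" and x: "plastic_point m \<in> T"
  shows "2 * (13 / 23) powr (1 / 4) \<le> triangle_diam T / triangle_area T powr (1 / 2)"
proof -
  have tri: "is_triangle T (vertex M 1) (vertex M 2) (vertex M 3)" using uc by (simp add: unimodular_coords_def)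
  let ?D = "real_of_int (dprod M)"
  note ar = unimodular_area[OF uc]
  have D0: "0 < ?D" using ar(2) by simp
  have d0: "0 \<le> triangle_diam T" by (rule order_trans[OF zero_le_dist triangle_diam_ge[OF tri]])
  have "1.50362 / ?D < (triangle_diam T)^2"
  proof (rule ccontr)
    assume n: "\<not> ?thesis"
    have le: "(dist p q)^2 \<le> 1.50362 / ?D" if "is_triangle T p q r" for p q r
    proof -
      have "(dist p q)^2 \<le> (triangle_diam T)^2" using triangle_diam_ge[OF that] by (intro power_mono) auto
      thus ?thesis using n by linarith
    qed
    show False
      by (rule no_fat_unimodular[OF uc x plastic_point_nth le[OF is_triangle_perm(1)[OF tri]]
            le[OF is_triangle_perm(2)[OF tri]] le[OF tri]])
  qed
  hence "1.50362 / ?D * (2 * ?D) \<le> (triangle_diam T)^2 * (2 * ?D)" using D0 by (intro mult_right_mono) auto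
  hence "3.00724 \<le> (triangle_diam T)^2 * (2 * ?D)" using D0 by simp
  also have "\<dots> = (triangle_diam T / triangle_area T powr (1/2))^2"
  proof -
    have "(triangle_area T powr (1/2))^2 = 1 / (2 * ?D)" unfolding ar(1) using D0 by (simp add: powr_half_sqrt)
    thus ?thesis unfolding power_divide by simp
  qed
  finally have 1: "3.00724 \<le> (triangle_diam T / triangle_area T powr (1/2))^2" .
  have "((13 / 23 :: real) powr (1 / 4))^2 = (13/23) powr (1/2)" by (subst powr_power) auto
  hence "(2 * (13 / 23) powr (1 / 4) :: real)^2 = 4 * sqrt (13/23)"
    by (simp add: power_mult_distrib powr_half_sqrt)
  also have "sqrt (13/23) \<le> 0.75181" by (rule real_le_lsqrt) (auto simp: power2_eq_square)
  finally have "(2 * (13 / 23) powr (1 / 4) :: real)^2 \<le> (triangle_diam T / triangle_area T powr (1/2))^2" using 1 by simp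
  thus ?thesis by (rule power2_le_imp_le) (use d0 in simp)
qed

lemma angles_bound: assumes uc: "unimodular_coords T M" and x: "plastic_point m \<in> T"
  shows "\<exists>\<alpha> \<in> triangle_angles T. \<alpha> \<le> arcsin (sqrt 23 / 6)"
proof (rule ccontr)
  assume "\<not> ?thesis"
  hence ang: "arcsin (sqrt 23 / 6) < angle_at a b c" if "is_triangle T a b c" for a b c
    using that by (force simp: triangle_angles_def)
  have tri: "is_triangle T (vertex M 1) (vertex M 2) (vertex M 3)" using uc by (simp add: unimodular_coords_def)
  have cr: "\<bar>cross (vertex M 1) (vertex M 2) (vertex M 3)\<bar> = 1 / dprod M"
    using uc by (intro cross_vertex) (auto simp: unimodular_coords_def)
  have side: "(dist a b)^2 \<le> 1.50362 * \<bar>cross a b c\<bar>" if "is_triangle T a b c" for a b c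
  proof (rule side_bound)
    show "a \<noteq> b" "a \<noteq> c" "b \<noteq> c" using that not_collinear_distinct unfolding is_triangle_def by blast+
  qed (rule ang[OF that], rule ang[OF is_triangle_perm(3)[OF that]])
  have perm: "cross b c a = cross a b c" "cross c a b = cross a b c" for a b c unfolding cross_def by algebra+
  have cr1: "cross (vertex M 2) (vertex M 3) (vertex M 1) = cross (vertex M 1) (vertex M 2) (vertex M 3)"
    and cr2: "cross (vertex M 3) (vertex M 1) (vertex M 2) = cross (vertex M 1) (vertex M 2) (vertex M 3)" by (rule perm)+
  have "(dist (vertex M 2) (vertex M 3))^2 \<le> 1.50362 / dprod M"
    using side[OF is_triangle_perm(1)[OF tri]] unfolding cr1 cr by simp
  moreover have "(dist (vertex M 3) (vertex M 1))^2 \<le> 1.50362 / dprod M"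
    using side[OF is_triangle_perm(2)[OF tri]] unfolding cr2 cr by simp
  moreover have "(dist (vertex M 1) (vertex M 2))^2 \<le> 1.50362 / dprod M"
    using side[OF tri] unfolding cr by simp
  ultimately show False by (rule no_fat_unimodular[OF uc x plastic_point_nth])
qed

section \<open>Infinitely many irrational points and the conclusion\<close>

lemma inj_plastic_point: "inj plastic_point"
proof (rule injI)
  fix m n assume "plastic_point m = plastic_point n"
  from arg_cong[OF this, of "\<lambda>x. x $ 1"] show "m = n" by (simp add: plastic_point_nth)
qed

lemma plastic_point_irrational: "plastic_point m \<notin> rational_points"
proof
  assume "plastic_point m \<in> rational_points"
  hence "phi \<in> \<rat>" by (simp add: rational_points_def plastic_point_nth)
  then obtain p q :: int where "0 < q" "phi = p / q" by (metis Rats_cases')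
  hence "real_of_int q * phi = p" by (metis less_irrefl nonzero_mult_div_cancel_left of_int_eq_0_iff times_divide_eq_right)
  hence "lin 0 q (- p) = 0" by (simp add: lin_def)
  from lin_eq_0[OF this] show False using \<open>0 < q\<close> by simp
qed

theorem theorem1p1:
  shows "infinite {x :: real^2. rank3_point x \<and>
    (\<forall>\<mu>. cf_expansion \<mu> \<longrightarrow>
      \<not> (\<exists>r :: nat \<Rightarrow> nat. strict_mono r \<and>
          (\<forall>n. \<mu> x (r (Suc n)) \<subset> \<mu> x (r n)) \<and>
          (\<forall>n. \<forall>\<alpha> \<in> triangle_angles (\<mu> x (r n)). \<alpha> > arcsin (sqrt 23 / 6)) \<and>
          (\<Inter>n. \<mu> x (r n)) = {x}) \<and>
      (\<forall>M :: nat \<Rightarrow> int^3^3. (\<forall>n. unimodular_coords (\<mu> x n) (M n)) \<longrightarrow>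
          liminf (\<lambda>n. ereal ((\<Sum>i\<in>UNIV. dist x (vertex (M n) i)) /
              of_int (2 * denom (M n) 1 * denom (M n) 2 * denom (M n) 3) powr (- 1 / 2)))
            \<ge> liminf (\<lambda>n. ereal (triangle_diam (\<mu> x n) / triangle_area (\<mu> x n) powr (1 / 2))) \<and>
          liminf (\<lambda>n. ereal (triangle_diam (\<mu> x n) / triangle_area (\<mu> x n) powr (1 / 2)))
            \<ge> ereal (2 * (13 / 23) powr (1 / 4))))}"
    (is "infinite ?S")
proof -
  have "plastic_point m \<in> ?S" for m
  proof (intro CollectI conjI allI impI)
    show "rank3_point (plastic_point m)" by (rule plastic_point_rank3)
  next
    fix \<mu> assume cf: "cf_expansion \<mu>"
    let ?x = "plastic_point m"
    have cf': "(\<forall>n. \<exists>M. unimodular_coords (\<mu> ?x n) M) \<and> (\<Inter>n. \<mu> ?x n) = {?x}"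
      using cf plastic_point_irrational[of m] unfolding cf_expansion_def by simp
    hence "?x \<in> (\<Inter>n. \<mu> ?x n)" by simp
    hence mem: "?x \<in> \<mu> ?x n" for n by (rule INT_D) simp
    show "\<not> (\<exists>r :: nat \<Rightarrow> nat. strict_mono r \<and>
          (\<forall>n. \<mu> ?x (r (Suc n)) \<subset> \<mu> ?x (r n)) \<and>
          (\<forall>n. \<forall>\<alpha> \<in> triangle_angles (\<mu> ?x (r n)). \<alpha> > arcsin (sqrt 23 / 6)) \<and>
          (\<Inter>n. \<mu> ?x (r n)) = {?x})"
    proof
      assume "\<exists>r :: nat \<Rightarrow> nat. strict_mono r \<and>
          (\<forall>n. \<mu> ?x (r (Suc n)) \<subset> \<mu> ?x (r n)) \<and>
          (\<forall>n. \<forall>\<alpha> \<in> triangle_angles (\<mu> ?x (r n)). \<alpha> > arcsin (sqrt 23 / 6)) \<and>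
          (\<Inter>n. \<mu> ?x (r n)) = {?x}"
      then obtain r :: "nat \<Rightarrow> nat"
        where r: "\<forall>n. \<forall>\<alpha> \<in> triangle_angles (\<mu> ?x (r n)). \<alpha> > arcsin (sqrt 23 / 6)"
        by (elim exE conjE) (rule that)
      \<comment> \<open>The first triangle of the subsequence already has a small angle.\<close>
      obtain M where "unimodular_coords (\<mu> ?x (r 0)) M" using cf' by blast
      from angles_bound[OF this mem] obtain \<alpha>
        where "\<alpha> \<in> triangle_angles (\<mu> ?x (r 0))" "\<alpha> \<le> arcsin (sqrt 23 / 6)" by (rule bexE)
      with r[rule_format, of \<alpha> 0] show False by simp
    qed
    fix M :: "nat \<Rightarrow> int^3^3" assume M: "\<forall>n. unimodular_coords (\<mu> ?x n) (M n)"
    show "liminf (\<lambda>n. ereal (triangle_diam (\<mu> ?x n) / triangle_area (\<mu> ?x n) powr (1 / 2)))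
      \<le> liminf (\<lambda>n. ereal ((\<Sum>i\<in>UNIV. dist ?x (vertex (M n) i)) /
              of_int (2 * denom (M n) 1 * denom (M n) 2 * denom (M n) 3) powr (- 1 / 2)))"
    \<comment> \<open>The comparison holds term by term, since by \<open>area_powr\<close> both
      quotients have the same denominator.\<close>
    proof (intro Liminf_mono always_eventually allI)
      fix n
      have uc: "unimodular_coords (\<mu> ?x n) (M n)" using M by blast
      hence "triangle_diam (\<mu> ?x n) \<le> (\<Sum>i\<in>UNIV. dist ?x (vertex (M n) i))"
        using triangle_diam_le by (simp add: unimodular_coords_def sum_3)
      thus "ereal (triangle_diam (\<mu> ?x n) / triangle_area (\<mu> ?x n) powr (1 / 2))
        \<le> ereal ((\<Sum>i\<in>UNIV. dist ?x (vertex (M n) i)) /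
              of_int (2 * denom (M n) 1 * denom (M n) 2 * denom (M n) 3) powr (- 1 / 2))"
        unfolding area_powr[OF uc] by (simp add: divide_right_mono)
    qed
    show "ereal (2 * (13 / 23) powr (1 / 4)) \<le> liminf (\<lambda>n. ereal (triangle_diam (\<mu> ?x n) / triangle_area (\<mu> ?x n) powr (1 / 2)))"
    proof (intro Liminf_bounded always_eventually allI)
      fix n
      show "ereal (2 * (13 / 23) powr (1 / 4)) \<le> ereal (triangle_diam (\<mu> ?x n) / triangle_area (\<mu> ?x n) powr (1 / 2))"
        using diam_area_bound[OF M[rule_format] mem] by simp
    qed
  qed
  hence "range plastic_point \<subseteq> ?S" by blast
  moreover have "infinite (range plastic_point)" using inj_plastic_point by (simp add: finite_image_iff)
  ultimately show ?thesis by (rule infinite_super)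
qed

end
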